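(* Let $(R,\mathfrak{m},K)$ be either a standard graded $K$-algebra or a Noetherian local ring, of prime characteristic $p$, and assume that $R$ is $F$-finite and $F$-pure. Let $\mathfrak{a}$ be a proper ideal of $R$, homogeneous in case $R$ is graded. Then $\mathrm{fpt}(\mathfrak{a})=c^{\mathfrak{m}}(\mathfrak{a})$ if and only if $c^{I_e}(\mathfrak{a})=c^{\mathfrak{m}^{[p^e]}}(\mathfrak{a})$ for all integers $e \in\mathbb{N}$.
   Context: Convention: $0\in\mathbb{N}$. A standard graded $K$-algebra is an $\mathbb{N}$-graded algebra $R$ with $R_0=K$ a field, generated over $K$ by finitely many elements of degree one; $\mathfrak{m}$ is its irrelevant maximal ideal. In the local case $\mathfrak{m}$ is the maximal ideal and $K=R/\mathfrak{m}$. For $e\in\mathbb{N}$, $F^e_*R$ denotes $R$ viewed as an $R$-module via the $e$-th iterated Frobenius $F^e:R\to R$, $r\mapsto r^{p^e}$. $R$ is $F$-finite if $F_*R$ is a finitely generated $R$-module; $R$ is $F$-pure if the Frobenius $F:R\to R$ is a pure morphism. For an ideal $J$, $J^{[p^e]}$ is the ideal generated by the $p^e$-th powers of the elements of $J$. For ideals $\mathfrak{a},J$ with $J$ proper and $\mathfrak{a}\subseteq\sqrt{J}$: $\nu^J_{\mathfrak{a}}(p^e)=\max\{t\in\mathbb{N}\mid \mathfrak{a}^t\not\subseteq J^{[p^e]}\}$ and the $F$-threshold is $c^J(\mathfrak{a})=\lim_{e\to\infty}\nu^J_{\mathfrak{a}}(p^e)/p^e$ (the limit exists). For $e\in\mathbb{N}$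 let $I_e=\{f\in R\mid \psi(F^e_*f)\in\mathfrak{m}\text{ for all } R\text{-linear maps }\psi:F^e_*R\to R\}$ (an ideal; $I_0=\mathfrak{m}$). For a proper ideal $\mathfrak{a}$ (homogeneous in the graded case), the $F$-pure threshold is $\mathrm{fpt}(\mathfrak{a})=\lim_{e\to\infty}b_{\mathfrak{a}}(p^e)/p^e$, where $b_{\mathfrak{a}}(p^e)=\max\{t\in\mathbb{N}\mid \mathfrak{a}^t\not\subseteq I_e\}$. *)

theory Defs
  imports "HOL-Algebra.Algebra" Complex_Main
begin

section \<open>Graded and local rings\<close>

locale standard_graded_algebra = cring R for R (structure) +
  fixes G :: "nat \<Rightarrow> 'a set"
  assumes graded_subgroup: "additive_subgroup (G i) R"
    and graded_mult: "\<lbrakk> x \<in> G i; y \<in> G j \<rbrakk> \<Longrightarrow> x \<otimes> y \<in> G (i + j)"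
    and graded_direct_sum: "x \<in> carrier R \<Longrightarrow>
      \<exists>!f. (\<forall>i. f i \<in> G i) \<and> finite {i. f i \<noteq> \<zero>} \<and> x = (\<Oplus>i\<in>{i. f i \<noteq> \<zero>}. f i)"
    and degree_zero_field: "subfield (G 0) R"
    and generated_in_degree_one:
      "\<exists>S. finite S \<and> S \<subseteq> G 1 \<and> generate_ring R (G 0 \<union> S) = carrier R"

definition irrelevant_ideal :: "('a, 'b) ring_scheme \<Rightarrow> (nat \<Rightarrow> 'a set) \<Rightarrow> 'a set" where
  "irrelevant_ideal R G =
     {x. \<exists>A f. finite A \<and> 0 \<notin> A \<and> (\<forall>i\<in>A. f i \<in> G i) \<and> x = (\<Oplus>\<^bsub>R\<^esub>i\<in>A. f i)}"

definition homogeneous_ideal :: "('a, 'b) ring_scheme \<Rightarrow> (nat \<Rightarrow> 'a set) \<Rightarrow> 'a set \<Rightarrow> bool" where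
  "homogeneous_ideal R G I \<longleftrightarrow> ideal I R \<and> (\<exists>H \<subseteq> (\<Union>i. G i). I = Idl\<^bsub>R\<^esub> H)"

locale noetherian_local_ring = cring R + noetherian_ring R for R (structure) +
  fixes \<mm> :: "'a set"
  assumes maximal: "maximalideal \<mm> R"
    and unique_maximal: "maximalideal I R \<Longrightarrow> I = \<mm>"


section \<open>Modules, tensor products and purity\<close>

text \<open>The codomain ring of \<open>\<phi> : R \<rightarrow> S\<close>, viewed as an \<open>R\<close>-module.\<close>

definition restrict_scalars ::
    "('r \<Rightarrow> 's) \<Rightarrow> ('s, 'b) ring_scheme \<Rightarrow> ('r, 's) module" where
  "restrict_scalars \<phi> S =
     \<lparr> carrier = carrier S, monoid.mult = (\<otimes>\<^bsub>S\<^esub>), one = \<one>\<^bsub>S\<^esub>,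
       ring.zero = \<zero>\<^bsub>S\<^esub>, ring.add = (\<oplus>\<^bsub>S\<^esub>),
       smult = (\<lambda>r x. \<phi> r \<otimes>\<^bsub>S\<^esub> x) \<rparr>"

definition linear_maps ::
    "('r, 'b) ring_scheme \<Rightarrow> ('r, 'm, 'c) module_scheme \<Rightarrow> ('r, 'n, 'd) module_scheme
      \<Rightarrow> ('m \<Rightarrow> 'n) set" where
  "linear_maps R M N =
     {h. h \<in> carrier M \<rightarrow> carrier N
       \<and> (\<forall>x\<in>carrier M. \<forall>y\<in>carrier M. h (x \<oplus>\<^bsub>M\<^esub> y) = h x \<oplus>\<^bsub>N\<^esub> h y)
       \<and> (\<forall>r\<in>carrier R. \<forall>x\<in>carrier M. h (r \<odot>\<^bsub>M\<^esub> x) = r \<odot>\<^bsub>N\<^esub> h x)}"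

definition finitely_generated_module ::
    "('r, 'b) ring_scheme \<Rightarrow> ('r, 'm, 'c) module_scheme \<Rightarrow> bool" where
  "finitely_generated_module R M \<longleftrightarrow>
     (\<exists>S. finite S \<and> S \<subseteq> carrier M \<and>
        (\<forall>x\<in>carrier M. \<exists>c \<in> S \<rightarrow> carrier R. x = (\<Oplus>\<^bsub>M\<^esub>s\<in>S. c s \<odot>\<^bsub>M\<^esub> s)))"

definition tensor_relators ::
    "('r, 'b) ring_scheme \<Rightarrow> ('r, 'm, 'c) module_scheme \<Rightarrow> ('r, 'n, 'd) module_scheme
      \<Rightarrow> ('m \<times> 'n \<Rightarrow>\<^sub>0 int) set" where
  "tensor_relators R M N =
     {frag_of (x \<oplus>\<^bsub>M\<^esub> x', y) - frag_of (x, y) - frag_of (x', y) | x x' y.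
        x \<in> carrier M \<and> x' \<in> carrier M \<and> y \<in> carrier N} \<union>
     {frag_of (x, y \<oplus>\<^bsub>N\<^esub> y') - frag_of (x, y) - frag_of (x, y') | x y y'.
        x \<in> carrier M \<and> y \<in> carrier N \<and> y' \<in> carrier N} \<union>
     {frag_of (r \<odot>\<^bsub>M\<^esub> x, y) - frag_of (x, r \<odot>\<^bsub>N\<^esub> y) | r x y.
        r \<in> carrier R \<and> x \<in> carrier M \<and> y \<in> carrier N}"

text \<open>\<open>M \<otimes>\<^sub>R N\<close> is the quotient of the free abelian group on \<open>M \<times> N\<close> by the subgroup
  \<open>tensor_kernel R M N\<close>; its elements are the cosets of that subgroup.\<close>

definition tensor_kernel ::
    "('r, 'b) ring_scheme \<Rightarrow> ('r, 'm, 'c) module_scheme \<Rightarrow> ('r, 'n, 'd) module_scheme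
      \<Rightarrow> ('m \<times> 'n \<Rightarrow>\<^sub>0 int) set" where
  "tensor_kernel R M N =
     generate (free_Abelian_group (carrier M \<times> carrier N)) (tensor_relators R M N)"

definition tensor_product ::
    "('r, 'b) ring_scheme \<Rightarrow> ('r, 'm, 'c) module_scheme \<Rightarrow> ('r, 'n, 'd) module_scheme
      \<Rightarrow> ('m \<times> 'n \<Rightarrow>\<^sub>0 int) set monoid" where
  "tensor_product R M N =
     free_Abelian_group (carrier M \<times> carrier N) Mod tensor_kernel R M N"

definition pure_tensor ::
    "('r, 'b) ring_scheme \<Rightarrow> ('r, 'm, 'c) module_scheme \<Rightarrow> ('r, 'n, 'd) module_scheme
      \<Rightarrow> 'm \<Rightarrow> 'n \<Rightarrow> ('m \<times> 'n \<Rightarrow>\<^sub>0 int) set" where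
  "pure_tensor R M N x y =
     tensor_kernel R M N #>\<^bsub>free_Abelian_group (carrier M \<times> carrier N)\<^esub> frag_of (x, y)"

text \<open>\<open>\<phi> : R \<rightarrow> S\<close> is pure if \<open>M \<rightarrow> M \<otimes>\<^sub>R S\<close>, \<open>x \<mapsto> x \<otimes> 1\<close>, is injective for every
  \<open>R\<close>-module \<open>M\<close>. HOL cannot quantify over types inside a formula, so the carriers of the
  test modules are taken from the single type \<open>(nat \<Rightarrow> 'r) set\<close>. This loses nothing: that type
  contains an isomorphic copy of every finitely generated \<open>R\<close>-module (the quotients of the
  \<open>R\<^sup>n\<close>, with cosets as elements), and an equation \<open>x \<otimes> 1 = 0\<close> in \<open>M \<otimes>\<^sub>R S\<close> already holds in
  \<open>M' \<otimes>\<^sub>R S\<close> for some finitely generated submodule \<open>M'\<close> of \<open>M\<close> containing \<open>x\<close>.\<close>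

definition pure_ring_hom ::
    "('r, 'b) ring_scheme \<Rightarrow> ('s, 'c) ring_scheme \<Rightarrow> ('r \<Rightarrow> 's) \<Rightarrow> bool" where
  "pure_ring_hom R S \<phi> \<longleftrightarrow> \<phi> \<in> ring_hom R S \<and>
     (\<forall>M :: ('r, (nat \<Rightarrow> 'r) set) module. module R M \<longrightarrow>
        inj_on (\<lambda>x. pure_tensor R M (restrict_scalars \<phi> S) x \<one>\<^bsub>S\<^esub>) (carrier M))"


section \<open>Frobenius\<close>

definition frobenius :: "('a, 'b) ring_scheme \<Rightarrow> nat \<Rightarrow> nat \<Rightarrow> 'a \<Rightarrow> 'a" where
  "frobenius R p e = (\<lambda>r. r [^]\<^bsub>R\<^esub> (p ^ e))"

definition frobenius_pushforward ::
    "('a, 'b) ring_scheme \<Rightarrow> nat \<Rightarrow> nat \<Rightarrow> ('a, 'a) module" where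
  "frobenius_pushforward R p e = restrict_scalars (frobenius R p e) R"

definition F_finite :: "('a, 'b) ring_scheme \<Rightarrow> nat \<Rightarrow> bool" where
  "F_finite R p \<longleftrightarrow> finitely_generated_module R (frobenius_pushforward R p 1)"

definition F_pure :: "('a, 'b) ring_scheme \<Rightarrow> nat \<Rightarrow> bool" where
  "F_pure R p \<longleftrightarrow> pure_ring_hom R R (frobenius R p 1)"

definition frobenius_power :: "('a, 'b) ring_scheme \<Rightarrow> nat \<Rightarrow> 'a set \<Rightarrow> nat \<Rightarrow> 'a set" where
  "frobenius_power R p J e = Idl\<^bsub>R\<^esub> (frobenius R p e ` J)"


section \<open>Thresholds\<close>

text \<open>The powers \<open>\<aa>\<^sup>t\<close> are taken in the monoid \<^term>\<open>ideals_set R\<close> of ideals under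
  multiplication of ideals; in particular \<open>\<aa>\<^sup>0 = R\<close>. Both maxima below are over finite nonempty
  sets, and both limits exist, for the ideals \<open>\<aa>\<close> and \<open>J\<close> for which these notions are meant:
  \<open>J\<close> proper with \<open>\<aa> \<subseteq> \<surd>J\<close>, respectively \<open>R\<close> being \<open>F\<close>-finite and \<open>F\<close>-pure and \<open>\<aa>\<close> proper
  (and homogeneous if \<open>R\<close> is graded).\<close>

definition nu :: "('a, 'b) ring_scheme \<Rightarrow> nat \<Rightarrow> 'a set \<Rightarrow> 'a set \<Rightarrow> nat \<Rightarrow> nat" where
  "nu R p J \<aa> e =
     Max {t :: nat. \<not> \<aa> [^]\<^bsub>ideals_set R\<^esub> t \<subseteq> frobenius_power R p J e}"

definition F_threshold :: "('a, 'b) ring_scheme \<Rightarrow> nat \<Rightarrow> 'a set \<Rightarrow> 'a set \<Rightarrow> real" where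
  "F_threshold R p J \<aa> = lim (\<lambda>e. real (nu R p J \<aa> e) / real (p ^ e))"

definition splitting_ideal :: "('a, 'b) ring_scheme \<Rightarrow> nat \<Rightarrow> 'a set \<Rightarrow> nat \<Rightarrow> 'a set" where
  "splitting_ideal R p \<mm> e =
     {f \<in> carrier R.
        \<forall>\<psi> \<in> linear_maps R (frobenius_pushforward R p e) (restrict_scalars (\<lambda>r. r) R).
          \<psi> f \<in> \<mm>}"

definition b_number :: "('a, 'b) ring_scheme \<Rightarrow> nat \<Rightarrow> 'a set \<Rightarrow> 'a set \<Rightarrow> nat \<Rightarrow> nat" where
  "b_number R p \<mm> \<aa> e =
     Max {t :: nat. \<not> \<aa> [^]\<^bsub>ideals_set R\<^esub> t \<subseteq> splitting_ideal R p \<mm> e}"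

definition fpt :: "('a, 'b) ring_scheme \<Rightarrow> nat \<Rightarrow> 'a set \<Rightarrow> 'a set \<Rightarrow> real" where
  "fpt R p \<mm> \<aa> = lim (\<lambda>e. real (b_number R p \<mm> \<aa> e) / real (p ^ e))"

end

theory Submission
  imports Defs
begin

text \<open>
  Write \<open>c\<close> for the \<open>F\<close>-threshold and \<open>N(J)\<close> for the least \<open>t\<close> with \<open>\<aa>\<^sup>t \<subseteq> J\<close>. If \<open>\<aa>\<close> has \<open>n\<close> generators,
  the pigeonhole principle gives \<open>N(J\<^sup>[\<^sup>q\<^sup>]) \<le> q (N(J) + n)\<close>; hence \<open>N(J\<^sup>[\<^sup>q\<^sup>]) / q\<close> converges, to \<open>c\<^sup>J(\<aa>)\<close>,
  and \<open>c\<^sup>J(\<aa>) \<le> N(J) + 2n\<close>. The inclusion \<open>I\<^sub>e\<^sup>[\<^sup>q\<^sup>] \<subseteq> I\<^sub>e\<^sub>+\<^sub>s\<close> for \<open>q = p\<^sup>s\<close> yields likewise that \<open>N(I\<^sub>e) / p\<^sup>e\<close>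
  converges, to \<open>fpt(\<aa>)\<close>, and that \<open>fpt(\<aa>) \<le> c(I\<^sub>e) / p\<^sup>e \<le> (N(I\<^sub>e) + 2n) / p\<^sup>e\<close>, so \<open>c(I\<^sub>e) / p\<^sup>e\<close> tends to
  \<open>fpt(\<aa>)\<close>. On the other side, \<open>\<mm>\<^sup>[\<^sup>q\<^sup>] \<subseteq> I\<^sub>e\<close> for \<open>q = p\<^sup>e\<close> gives \<open>c(I\<^sub>e) \<le> c(\<mm>\<^sup>[\<^sup>q\<^sup>]) = q c(\<mm>)\<close>.
  Both implications follow from \<open>fpt(\<aa>) \<le> c(I\<^sub>e) / p\<^sup>e \<le> c(\<mm>)\<close> and this limit. In the graded case
  finite generation of \<open>\<aa>\<close> is Hilbert's basis theorem.\<close>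

section \<open>Frobenius powers of ideals\<close>

context cring
begin

text \<open>Closure under negation comes from multiplication by
  \<open>\<ominus> \<one>\<close>.\<close>

lemma ideal_closedI:
  assumes "I \<subseteq> carrier R" "\<zero> \<in> I"
    and add: "\<And>x y. x \<in> I \<Longrightarrow> y \<in> I \<Longrightarrow> x \<oplus> y \<in> I"
    and mult: "\<And>x r. x \<in> I \<Longrightarrow> r \<in> carrier R \<Longrightarrow> r \<otimes> x \<in> I"
  shows "ideal I R"
proof (rule idealI[OF ring_axioms])
  show "subgroup I (add_monoid R)"
  proof (rule add.subgroupI)
    show "\<ominus> x \<in> I" if "x \<in> I" for x
      using mult[OF that, of "\<ominus> \<one>"] that assms(1) by (simp add: l_minus subset_iff)
  qed (use assms in auto)
  show "x \<otimes> r \<in> I" if "x \<in> I" "r \<in> carrier R" for x r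
    using mult[OF that] that assms(1) by (simp add: m_comm subset_iff)
qed (use mult in auto)

lemma ideal_zero_mem: "ideal I R \<Longrightarrow> \<zero> \<in> I"
  by (meson additive_subgroup.zero_closed ideal.axioms(1))

lemma ideal_add_mem: "ideal I R \<Longrightarrow> x \<in> I \<Longrightarrow> y \<in> I \<Longrightarrow> x \<oplus> y \<in> I"
  by (meson additive_subgroup.a_closed ideal.axioms(1))

text \<open>The colon ideal \<open>(I : x)\<close>. It lets a condition of the form
  \<open>x \<otimes> y \<in> I\<close> be checked on generators \<open>y\<close> only.\<close>

lemma ideal_quotient_element_ideal:
  assumes "ideal I R" "x \<in> carrier R"
  shows "ideal {y \<in> carrier R. x \<otimes> y \<in> I} R"
proof (rule ideal_closedI)
  show "r \<otimes> y \<in> {y \<in> carrier R. x \<otimes> y \<in> I}"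
    if "y \<in> {y \<in> carrier R. x \<otimes> y \<in> I}" "r \<in> carrier R" for y r
  proof -
    have "r \<otimes> (x \<otimes> y) \<in> I" using that assms by (auto intro: ideal.I_l_closed)
    then show ?thesis using that assms by (simp add: m_lcomm)
  qed
qed (use assms in \<open>auto simp: r_distr ideal_zero_mem ideal_add_mem\<close>)

lemma binomial_expansion:
  fixes n :: nat
  assumes [simp]: "x \<in> carrier R" "y \<in> carrier R"
  shows "(x \<oplus> y) [^] n = (\<Oplus>k\<in>{..n}. [((n choose k)::nat)] \<cdot> (x [^] k \<otimes> y [^] (n - k)))"
proof (induction n)
  case 0
  show ?case by (simp add: add.nat_pow_Suc)
next
  case (Suc n)
  define T where "T = (\<lambda>n k. [((n choose k)::nat)] \<cdot> (x [^] k \<otimes> y [^] (n - k)))"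
  have [simp]: "T n k \<in> carrier R" for n k by (simp add: T_def)
  have T0: "T (Suc n) 0 = y \<otimes> T n 0"
    by (simp add: T_def add_pow_rdistr m_comm)
  \<comment> \<open>Pascal's rule for the terms.\<close>
  have TS: "T (Suc n) (Suc k) = x \<otimes> T n k \<oplus> y \<otimes> T n (Suc k)" if "k \<le> n" for k
  proof -
    have 1: "x \<otimes> T n k = [((n choose k)::nat)] \<cdot> (x [^] Suc k \<otimes> y [^] (n - k))"
      unfolding T_def by (simp add: add_pow_rdistr m_ac)
    have 2: "y \<otimes> T n (Suc k) = [((n choose Suc k)::nat)] \<cdot> (x [^] Suc k \<otimes> y [^] (n - k))"
    \<comment> \<open>For \<open>k = n\<close> both sides vanish because
      \<open>n choose Suc n\<close> is zero; otherwise the truncated subtraction in the exponent is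
      genuine.\<close>
    proof (cases "k = n")
      case True
      then show ?thesis by (simp add: T_def binomial_eq_0)
    next
      case False
      with that have "n - k = Suc (n - Suc k)" by simp
      then show ?thesis unfolding T_def by (simp add: add_pow_rdistr m_ac)
    qed
    show ?thesis
      unfolding 1 2 by (simp add: T_def add.nat_pow_mult del: nat_pow_Suc)
  qed
  \<comment> \<open>This vanishing top term lets the shifted sum, completed by \<open>T n 0\<close>,
    be read as the sum over \<open>{..n}\<close> again.\<close>
  have last: "T n (Suc n) = \<zero>" by (simp add: T_def binomial_eq_0)
  let ?S = "\<Oplus>k\<in>{..n}. T n k"
  have "(\<Oplus>k\<in>{..Suc n}. T (Suc n) k) = (\<Oplus>k\<in>{..n}. T (Suc n) (Suc k)) \<oplus> T (Suc n) 0"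
    by (rule finsum_Suc2) auto
  also have "(\<Oplus>k\<in>{..n}. T (Suc n) (Suc k)) = (\<Oplus>k\<in>{..n}. x \<otimes> T n k \<oplus> y \<otimes> T n (Suc k))"
    by (rule add.finprod_cong') (auto simp: TS)
  also have "\<dots> = x \<otimes> ?S \<oplus> y \<otimes> (\<Oplus>k\<in>{..n}. T n (Suc k))"
    by (simp add: finsum_addf finsum_rdistr Pi_def)
  also have "\<dots> \<oplus> T (Suc n) 0 = x \<otimes> ?S \<oplus> y \<otimes> ((\<Oplus>k\<in>{..n}. T n (Suc k)) \<oplus> T n 0)"
    by (simp add: T0 r_distr a_assoc)
  also have "(\<Oplus>k\<in>{..n}. T n (Suc k)) \<oplus> T n 0 = (\<Oplus>k\<in>{..Suc n}. T n k)"
    by (rule finsum_Suc2[symmetric]) auto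
  also have "\<dots> = ?S"
    by (subst finsum_Suc) (auto simp: last)
  also have "x \<otimes> ?S \<oplus> y \<otimes> ?S = ?S \<otimes> (x \<oplus> y)"
    by (simp add: l_distr m_comm)
  also have "?S = (x \<oplus> y) [^] n" using Suc by (simp add: T_def)
  finally show ?case by (simp add: T_def)
qed

end

section \<open>Additivity of Frobenius and Frobenius powers in characteristic
  \<open>p\<close>\<close>

locale prime_characteristic_ring = cring R for R (structure) +
  fixes p :: nat
  assumes prime_p: "Factorial_Ring.prime p" and char_p: "[p] \<cdot> \<one> = \<zero>"
begin

lemma p_ge_2: "p \<ge> 2"
  using prime_p prime_ge_2_nat by blast

lemma multiple_p_eq_zero:
  assumes "p dvd k" "x \<in> carrier R"
  shows "[k] \<cdot> x = \<zero>"
proof -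
  obtain j where k: "k = j * p" using assms(1) by (metis dvdE mult.commute)
  have "[p] \<cdot> ([j] \<cdot> x) = \<zero>"
    using add_pow_ldistr[of \<one> "[j] \<cdot> x" p] assms(2) char_p by simp
  then show ?thesis
    using add.nat_pow_pow[OF assms(2), of p j] by (simp add: k)
qed

text \<open>Induction on \<open>e\<close> reduces to a single Frobenius, where \<open>p\<close>
  divides \<open>p choose k\<close> for \<open>0 < k < p\<close> and only the two outer binomial
  terms survive.\<close>

lemma frobenius_add:
  assumes "x \<in> carrier R" "y \<in> carrier R"
  shows "(x \<oplus> y) [^] (p ^ e) = x [^] (p ^ e) \<oplus> y [^] (p ^ e)"
proof (induction e)
  case 0
  show ?case using assms by simp
next
  case (Suc e)
  have step: "(u \<oplus> v) [^] p = u [^] p \<oplus> v [^] p" if [simp]: "u \<in> carrier R" "v \<in> carrier R" for u v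
  proof -
    let ?t = "\<lambda>k. [((p choose k)::nat)] \<cdot> (u [^] k \<otimes> v [^] (p - k))"
    have "(u \<oplus> v) [^] p = (\<Oplus>k\<in>{..p}. ?t k)"
      by (rule binomial_expansion) simp_all
    also have "\<dots> = (\<Oplus>k\<in>{0, p}. ?t k)"
    proof (rule add.finprod_mono_neutral_cong)
      show "?t k = \<zero>" if "k \<in> {..p} - {0, p}" for k
        using that by (intro multiple_p_eq_zero) (auto intro!: dvd_choose_prime prime_p)
    qed auto
    also have "\<dots> = u [^] p \<oplus> v [^] p"
      using p_ge_2 by (simp add: a_comm)
    finally show ?thesis .
  qed
  have pow: "u [^] (p ^ Suc e) = (u [^] (p ^ e)) [^] p" if "u \<in> carrier R" for u
    using nat_pow_pow[OF that, of "p ^ e" p] by (simp add: mult.commute)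
  show ?case using assms by (simp only: pow a_closed Suc) (simp add: step)
qed

lemma pow_pow_p: "x \<in> carrier R \<Longrightarrow> (x [^] (p ^ d)) [^] (p ^ e) = x [^] (p ^ (d + e))"
  by (simp add: nat_pow_pow power_add)

lemma frobenius_power_ideal:
  assumes "J \<subseteq> carrier R"
  shows "ideal (frobenius_power R p J e) R"
  unfolding frobenius_power_def
  by (rule genideal_ideal) (use assms in \<open>auto simp: frobenius_def\<close>)

lemma frobenius_power_subset:
  assumes "ideal I R" "\<And>x. x \<in> J \<Longrightarrow> x [^] (p ^ e) \<in> I"
  shows "frobenius_power R p J e \<subseteq> I"
  unfolding frobenius_power_def
  by (rule genideal_minimal) (use assms in \<open>auto simp: frobenius_def\<close>)

lemma pow_in_frobenius_power:
  assumes "J \<subseteq> carrier R" "x \<in> J"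
  shows "x [^] (p ^ e) \<in> frobenius_power R p J e"
proof -
  have "frobenius R p e ` J \<subseteq> Idl (frobenius R p e ` J)"
    by (rule genideal_self) (use assms in \<open>auto simp: frobenius_def\<close>)
  then show ?thesis using assms by (auto simp: frobenius_power_def frobenius_def)
qed

lemma frobenius_power_mono:
  assumes "J \<subseteq> J'" "J' \<subseteq> carrier R"
  shows "frobenius_power R p J e \<subseteq> frobenius_power R p J' e"
  by (rule frobenius_power_subset[OF frobenius_power_ideal])
     (use assms in \<open>auto intro: pow_in_frobenius_power\<close>)

text \<open>The contraction of \<open>I\<close> along an iterated Frobenius; additivity of Frobenius
  gives closure under sums. Conditions on \<open>p ^ e\<close>-th powers can thus be checked on
  generators.\<close>

lemma frobenius_preimage_ideal:
  assumes "ideal I R"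
  shows "ideal {x \<in> carrier R. x [^] (p ^ e) \<in> I} R"
proof (rule ideal_closedI)
  have "\<zero> [^] (p ^ e) = \<zero>"
    using p_ge_2 by (intro nat_pow_zero) auto
  then show "\<zero> \<in> {x \<in> carrier R. x [^] (p ^ e) \<in> I}"
    using ideal_zero_mem[OF assms] by simp
qed (use assms in \<open>auto simp: frobenius_add ideal_add_mem nat_pow_distrib intro: ideal.I_l_closed\<close>)

lemma frobenius_power_frobenius_power:
  assumes "J \<subseteq> carrier R"
  shows "frobenius_power R p (frobenius_power R p J d) e = frobenius_power R p J (d + e)"
proof (rule subset_antisym)
  let ?I = "frobenius_power R p J (d + e)"
  have I: "ideal ?I R" by (rule frobenius_power_ideal[OF assms])
  \<comment> \<open>A general element of the inner Frobenius power is a combination of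
    \<open>p ^ d\<close>-th powers, so the claim is tested on these powers through the contraction
    of \<open>?I\<close>.\<close>
  have "frobenius_power R p J d \<subseteq> {x \<in> carrier R. x [^] (p ^ e) \<in> ?I}"
    by (rule frobenius_power_subset[OF frobenius_preimage_ideal[OF I]])
       (use assms in \<open>auto simp: pow_pow_p subset_iff intro: pow_in_frobenius_power\<close>)
  then show "frobenius_power R p (frobenius_power R p J d) e \<subseteq> ?I"
    by (intro frobenius_power_subset[OF I]) auto
next
  have sub: "frobenius_power R p J d \<subseteq> carrier R"
    using ideal.Icarr[OF frobenius_power_ideal[OF assms]] by blast
  show "frobenius_power R p J (d + e) \<subseteq> frobenius_power R p (frobenius_power R p J d) e"
  proof (rule frobenius_power_subset[OF frobenius_power_ideal[OF sub]])
    fix x assume "x \<in> J"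
    then show "x [^] (p ^ (d + e)) \<in> frobenius_power R p (frobenius_power R p J d) e"
      using pow_in_frobenius_power[OF sub pow_in_frobenius_power[OF assms]] assms
      by (metis pow_pow_p subsetD)
  qed
qed

lemma frobenius_power_0:
  assumes "ideal J R"
  shows "frobenius_power R p J 0 = J"
proof -
  have "J \<subseteq> carrier R" using ideal.Icarr[OF assms] by blast
  then have "frobenius R p 0 ` J = J" by (force simp: frobenius_def image_iff subset_iff)
  then show ?thesis
    unfolding frobenius_power_def
    by (metis assms genideal_minimal genideal_self \<open>J \<subseteq> carrier R\<close> subset_antisym subset_refl)
qed

end

section \<open>Powers of ideals\<close>

context cring
begin

abbreviation ideal_pow :: "'a set \<Rightarrow> nat \<Rightarrow> 'a set"
  where "ideal_pow I n \<equiv> I [^]\<^bsub>ideals_set R\<^esub> n"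

lemma ideal_pow_0: "ideal_pow I 0 = carrier R"
  by (simp add: ideals_set_def)

lemma ideal_pow_Suc: "ideal_pow I (Suc n) = ideal_prod R (ideal_pow I n) I"
  by (simp add: ideals_set_def)

lemma ideal_pow_ideal: "ideal I R \<Longrightarrow> ideal (ideal_pow I n) R"
  by (induction n) (simp_all only: ideal_pow_0 ideal_pow_Suc oneideal ideal_prod_is_ideal)

lemma ideal_pow_mult_mem:
  assumes "ideal I R" "x \<in> ideal_pow I m" "y \<in> ideal_pow I n"
  shows "x \<otimes> y \<in> ideal_pow I (m + n)"
proof -
  interpret M: comm_monoid "ideals_set R" by (rule ideals_set_is_comm_monoid)
  have "ideal_prod R (ideal_pow I m) (ideal_pow I n) = ideal_pow I (m + n)"
    using M.nat_pow_mult[of I m n] assms(1) by (simp add: ideals_set_def)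
  then show ?thesis using ideal_prod.prod[OF assms(2,3), of R] by simp
qed

lemma pow_in_ideal_pow:
  assumes "ideal I R" "x \<in> I"
  shows "x [^] (n::nat) \<in> ideal_pow I n"
proof (induction n)
  case 0
  show ?case by (simp only: ideal_pow_0 nat_pow_0 one_closed)
next
  case (Suc n)
  show ?case
    unfolding ideal_pow_Suc nat_pow_Suc by (rule ideal_prod.prod[OF Suc assms(2)])
qed

lemma ideal_pow_antimono:
  assumes "ideal I R" "m \<le> n"
  shows "ideal_pow I n \<subseteq> ideal_pow I m"
  using assms(2)
proof (induction n rule: dec_induct)
  case (step n)
  then show ?case
    using ideal_prod_inter[OF ideal_pow_ideal[OF assms(1), of n] assms(1)]
    unfolding ideal_pow_Suc by (meson le_inf_iff subset_trans)
qed simp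

abbreviation list_prod :: "'a list \<Rightarrow> 'a"
  where "list_prod xs \<equiv> foldr (\<otimes>) xs \<one>"

lemma list_prod_closed: "set xs \<subseteq> carrier R \<Longrightarrow> list_prod xs \<in> carrier R"
  by (induction xs) auto

lemma list_prod_in_ideal_pow:
  assumes "ideal I R" "set xs \<subseteq> I"
  shows "list_prod xs \<in> ideal_pow I (length xs)"
  using assms(2)
proof (induction xs)
  case Nil
  show ?case by (simp only: foldr_Nil id_apply list.size ideal_pow_0 one_closed)
next
  case (Cons x xs)
  have "x \<in> ideal_pow I 1"
    using pow_in_ideal_pow[OF assms(1), of x 1] Cons.prems ideal.Icarr[OF assms(1)] by auto
  then show ?case
    using ideal_pow_mult_mem[OF assms(1), of x 1 "list_prod xs" "length xs"] Cons by simp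
qed

text \<open>The \<open>n\<close>-fold products of generators generate the \<open>n\<close>-th power.
  The induction lets \<open>J\<close> vary, because peeling off one generator \<open>x\<close>
  replaces \<open>J\<close> by the colon ideal \<open>(J : x)\<close>.\<close>

lemma ideal_pow_subset:
  assumes I: "I = Idl S" "S \<subseteq> carrier R" and J: "ideal J R"
    and gen: "\<And>xs. set xs \<subseteq> S \<Longrightarrow> length xs = n \<Longrightarrow> list_prod xs \<in> J"
  shows "ideal_pow I n \<subseteq> J"
  using J gen
proof (induction n arbitrary: J)
  case 0
  then have "\<one> \<in> J" by force
  then show ?case
    using ideal.one_imp_carrier[OF \<open>ideal J R\<close>] by (simp only: ideal_pow_0 subset_refl)
next
  case (Suc n)
  have II: "ideal I R" unfolding I(1) by (rule genideal_ideal[OF I(2)])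
  have *: "x \<otimes> y \<in> J" if "x \<in> S" "y \<in> ideal_pow I n" for x y
  proof -
    have x: "x \<in> carrier R" using that(1) I(2) by blast
    have "ideal_pow I n \<subseteq> {y \<in> carrier R. x \<otimes> y \<in> J}"
    proof (rule Suc.IH[OF ideal_quotient_element_ideal[OF Suc.prems(1) x]])
      fix xs assume xs: "set xs \<subseteq> S" "length xs = n"
      then have "list_prod (x # xs) \<in> J" using that(1) by (intro Suc.prems(2)) auto
      moreover have "list_prod xs \<in> carrier R" using xs I(2) by (intro list_prod_closed) blast
      ultimately show "list_prod xs \<in> {y \<in> carrier R. x \<otimes> y \<in> J}" by simp
    qed
    then show ?thesis using that(2) by blast
  qed
  \<comment> \<open>With \<open>y\<close> fixed, the admissible \<open>z\<close> form a colon ideal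
    containing \<open>S\<close>, hence all of \<open>I\<close>.\<close>
  have **: "y \<otimes> z \<in> J" if "y \<in> ideal_pow I n" "z \<in> I" for y z
  proof -
    have y: "y \<in> carrier R" by (rule ideal.Icarr[OF ideal_pow_ideal[OF II] that(1)])
    have "Idl S \<subseteq> {z \<in> carrier R. y \<otimes> z \<in> J}"
    proof (rule genideal_minimal[OF ideal_quotient_element_ideal[OF Suc.prems(1) y]], rule subsetI)
      fix x assume "x \<in> S"
      with *[OF this that(1)] y I(2) show "x \<in> {z \<in> carrier R. y \<otimes> z \<in> J}"
        by (auto simp: m_comm)
    qed
    then show ?thesis using that(2) I(1) by blast
  qed
  show ?case
  proof
    fix z assume "z \<in> ideal_pow I (Suc n)"
    then show "z \<in> J" unfolding ideal_pow_Suc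
      by (induction rule: ideal_prod.induct) (use ** ideal_add_mem[OF Suc.prems(1)] in auto)
  qed
qed

lemma list_prod_extract:
  assumes "set xs \<subseteq> carrier R" "x \<in> carrier R"
  shows "list_prod xs = x [^] count_list xs x \<otimes> list_prod (filter (\<lambda>y. y \<noteq> x) xs)"
  using assms(1)
proof (induction xs)
  case (Cons y xs)
  have "list_prod (filter (\<lambda>y. y \<noteq> x) xs) \<in> carrier R"
    using Cons.prems by (intro list_prod_closed) auto
  then show ?case using Cons assms(2) by (auto simp: m_ac)
qed simp

text \<open>By the pigeonhole principle, among \<open>card S * q\<close> factors taken from \<open>S\<close> one occurs
  \<open>q\<close> times.\<close>

lemma ideal_pow_subset_of_powers:
  assumes I: "I = Idl S" "S \<subseteq> carrier R" "finite S" and J: "ideal J R"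
    and n: "q + n \<ge> card S * q" "q > 0"
    and pow: "\<And>x y. x \<in> S \<Longrightarrow> y \<in> ideal_pow I n \<Longrightarrow> x [^] q \<otimes> y \<in> J"
  shows "ideal_pow I (q + n) \<subseteq> J"
proof (rule ideal_pow_subset[OF I(1,2) J])
  fix xs assume xs: "set xs \<subseteq> S" "length xs = q + n"
  have II: "ideal I R" unfolding I(1) by (rule genideal_ideal[OF I(2)])
  have SI: "S \<subseteq> I" unfolding I(1) by (rule genideal_self[OF I(2)])
  have "\<exists>x\<in>S. count_list xs x \<ge> q"
  proof (rule ccontr)
    assume "\<not> (\<exists>x\<in>S. count_list xs x \<ge> q)"
    \<comment> \<open>The strict comparison of sums requires a nonempty index set; an empty
      \<open>S\<close> would force \<open>xs\<close> to be empty, against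
      \<open>q > 0\<close>.\<close>
    moreover have "S \<noteq> {}" using xs n(2) by auto
    ultimately have "sum (count_list xs) S < (\<Sum>x\<in>S. q)"
      using I(3) by (intro sum_strict_mono) (auto simp: not_le)
    then show False using sum_count_set[OF xs(1) I(3)] xs(2) n(1) by simp
  qed
  then obtain x where x: "x \<in> S" "count_list xs x \<ge> q" by blast
  then have xc: "x \<in> carrier R" using I(2) by blast
  define c where "c = count_list xs x"
  define ys where "ys = filter (\<lambda>y. y \<noteq> x) xs"
  have "length ys + c = q + n"
    unfolding ys_def c_def xs(2)[symmetric]
    by (induction xs) auto
  \<comment> \<open>Setting aside \<open>q\<close> copies of \<open>x\<close> leaves
    \<open>c - q\<close> copies together with \<open>ys\<close>, in all \<open>n\<close> factors
    from \<open>I\<close>.\<close>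
  then have len: "(c - q) + length ys = n" using x(2) by (simp add: c_def)
  have ysc: "list_prod ys \<in> carrier R" using xs I(2) by (intro list_prod_closed) (auto simp: ys_def)
  have "x [^] (c - q) \<in> ideal_pow I (c - q)"
    using x(1) SI by (intro pow_in_ideal_pow[OF II]) blast
  moreover have "list_prod ys \<in> ideal_pow I (length ys)"
    using xs(1) SI by (intro list_prod_in_ideal_pow[OF II]) (auto simp: ys_def)
  ultimately have "x [^] (c - q) \<otimes> list_prod ys \<in> ideal_pow I n"
    unfolding len[symmetric] by (rule ideal_pow_mult_mem[OF II])
  from pow[OF x(1) this] have "(x [^] q \<otimes> x [^] (c - q)) \<otimes> list_prod ys \<in> J"
    using xc ysc by (simp add: m_assoc)
  also have "x [^] q \<otimes> x [^] (c - q) = x [^] c"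
    using x(2) xc by (simp add: nat_pow_mult c_def)
  also have "x [^] c \<otimes> list_prod ys = list_prod xs"
    unfolding c_def ys_def using xs(1) I(2) xc by (intro list_prod_extract[symmetric]) auto
  finally show "list_prod xs \<in> J" .
qed

end

section \<open>Ordinary powers inside Frobenius powers\<close>

context prime_characteristic_ring
begin

text \<open>Induction on \<open>t\<close> with \<open>q = p ^ e\<close>: among
  \<open>q * (Suc t + card S)\<close> generators one occurs \<open>q\<close> times. Removing
  \<open>x [^] q\<close> leaves an element of the Frobenius power of \<open>ideal_pow I t\<close>,
  and multiplying back by \<open>x [^] q\<close> raises \<open>t\<close> by one.\<close>

lemma ideal_pow_subset_frobenius_power_pow:
  assumes I: "I = Idl S" "S \<subseteq> carrier R" "finite S"
  shows "ideal_pow I (p ^ e * (t + card S)) \<subseteq> frobenius_power R p (ideal_pow I t) e"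
proof -
  have II: "ideal I R" unfolding I(1) by (rule genideal_ideal[OF I(2)])
  have SI: "S \<subseteq> I" unfolding I(1) by (rule genideal_self[OF I(2)])
  have q: "p ^ e > 0" using p_ge_2 by simp
  have carr: "ideal_pow I t \<subseteq> carrier R" for t
    using ideal.Icarr[OF ideal_pow_ideal[OF II]] by blast
  note fid = frobenius_power_ideal[OF carr]
  show ?thesis
  proof (induction t)
    case 0
    have "\<one> [^] (p ^ e) \<in> frobenius_power R p (ideal_pow I 0) e"
      by (rule pow_in_frobenius_power[OF carr]) (simp only: ideal_pow_0 one_closed)
    then have "frobenius_power R p (ideal_pow I 0) e = carrier R"
      by (intro ideal.one_imp_carrier[OF fid]) simp
    then show ?case using carr by (simp only:)
  next
    case (Suc t)
    let ?J = "frobenius_power R p (ideal_pow I (Suc t)) e"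
    let ?n = "p ^ e * (t + card S)"
    have "ideal_pow I (p ^ e + ?n) \<subseteq> ?J"
    proof (rule ideal_pow_subset_of_powers[OF I fid _ q])
      show "card S * p ^ e \<le> p ^ e + ?n" by (simp add: algebra_simps)
      fix x y assume x: "x \<in> S" and y: "y \<in> ideal_pow I ?n"
      have xc: "x \<in> carrier R" using x I(2) by blast
      \<comment> \<open>On a generator \<open>z [^] (p ^ e)\<close> the product with
        \<open>x [^] (p ^ e)\<close> is the \<open>p ^ e\<close>-th power of
        \<open>z \<otimes> x\<close>, which lies in the next power of \<open>I\<close>.\<close>
      have "frobenius_power R p (ideal_pow I t) e \<subseteq> {y \<in> carrier R. x [^] (p ^ e) \<otimes> y \<in> ?J}"
      proof (rule frobenius_power_subset[OF ideal_quotient_element_ideal[OF fid]])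
        fix z assume z: "z \<in> ideal_pow I t"
        have zc: "z \<in> carrier R" using z carr by blast
        have "z \<otimes> x \<in> ideal_pow I (Suc t)"
          unfolding ideal_pow_Suc using x SI z by (intro ideal_prod.prod) auto
        from pow_in_frobenius_power[OF carr this, of e]
        show "z [^] (p ^ e) \<in> {y \<in> carrier R. x [^] (p ^ e) \<otimes> y \<in> ?J}"
          using xc zc by (simp add: nat_pow_distrib m_comm)
      qed (use xc in simp)
      then show "x [^] (p ^ e) \<otimes> y \<in> ?J" using Suc.IH y by blast
    qed
    moreover have "p ^ e + ?n = p ^ e * (Suc t + card S)" by (simp add: algebra_simps)
    ultimately show ?case by (simp only:)
  qed
qed

lemma ideal_pow_subset_frobenius_power:
  assumes "I = Idl S" "S \<subseteq> carrier R" "finite S" "ideal_pow I t \<subseteq> J" "J \<subseteq> carrier R"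
  shows "ideal_pow I (p ^ e * (t + card S)) \<subseteq> frobenius_power R p J e"
  using ideal_pow_subset_frobenius_power_pow[OF assms(1-3)] frobenius_power_mono[OF assms(4,5)]
  by (rule subset_trans)

end

section \<open>Splitting ideals\<close>

context prime_characteristic_ring
begin

abbreviation frobenius_linear_maps :: "nat \<Rightarrow> ('a \<Rightarrow> 'a) set"
  where "frobenius_linear_maps e \<equiv>
    linear_maps R (frobenius_pushforward R p e) (restrict_scalars (\<lambda>r. r) R)"

text \<open>Unfolds the twisted scalar action: these are the \<open>p^(-e)\<close>-linear maps, also
  called Cartier maps.\<close>

lemma frobenius_linear_maps_iff:
  "\<psi> \<in> frobenius_linear_maps e \<longleftrightarrow> \<psi> \<in> carrier R \<rightarrow> carrier R
    \<and> (\<forall>x\<in>carrier R. \<forall>y\<in>carrier R. \<psi> (x \<oplus> y) = \<psi> x \<oplus> \<psi> y)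
    \<and> (\<forall>r\<in>carrier R. \<forall>x\<in>carrier R. \<psi> (r [^] (p ^ e) \<otimes> x) = r \<otimes> \<psi> x)"
  by (simp add: linear_maps_def frobenius_pushforward_def restrict_scalars_def frobenius_def)

lemma splitting_ideal_ideal:
  assumes "ideal M R"
  shows "ideal (splitting_ideal R p M e) R"
proof (rule ideal_closedI)
  \<comment> \<open>Homogeneity with the scalar \<open>\<zero>\<close> gives this, as
    \<open>\<zero> [^] (p ^ e)\<close> is \<open>\<zero>\<close>.\<close>
  have zero: "\<psi> \<zero> = \<zero>" if "\<psi> \<in> frobenius_linear_maps e" for \<psi>
  proof -
    have "\<zero> [^] (p ^ e) = \<zero>"
      using p_ge_2 by (intro nat_pow_zero) auto
    moreover have "\<psi> (\<zero> [^] (p ^ e) \<otimes> \<zero>) = \<zero> \<otimes> \<psi> \<zero>" "\<psi> \<zero> \<in> carrier R"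
      using that unfolding frobenius_linear_maps_iff by blast+
    ultimately show ?thesis by simp
  qed
  have "\<psi> \<zero> \<in> M" if "\<psi> \<in> frobenius_linear_maps e" for \<psi>
    unfolding zero[OF that] by (rule ideal_zero_mem[OF assms])
  then show "\<zero> \<in> splitting_ideal R p M e"
    by (simp add: splitting_ideal_def)
  fix f g r assume f: "f \<in> splitting_ideal R p M e"
  {
    assume "g \<in> splitting_ideal R p M e"
    with f ideal_add_mem[OF assms] show "f \<oplus> g \<in> splitting_ideal R p M e"
      unfolding splitting_ideal_def mem_Collect_eq
      by (auto simp: frobenius_linear_maps_iff)
  }
  assume r: "r \<in> carrier R"
  \<comment> \<open>Precomposing a Cartier map with multiplication by \<open>r\<close> gives a
    Cartier map again, so the condition on \<open>f\<close> passes to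
    \<open>r \<otimes> f\<close>.\<close>
  have "(\<lambda>x. \<psi> (r \<otimes> x)) \<in> frobenius_linear_maps e" if "\<psi> \<in> frobenius_linear_maps e" for \<psi>
    using that r unfolding frobenius_linear_maps_iff
    by (auto simp: r_distr m_lcomm[of r])
  with f r show "r \<otimes> f \<in> splitting_ideal R p M e"
    unfolding splitting_ideal_def by auto
qed (auto simp: splitting_ideal_def)

text \<open>Precomposing a \<open>p^(-(e+s))\<close>-linear map with the \<open>s\<close>-th
  Frobenius yields a \<open>p^(-e)\<close>-linear map, whose value at \<open>f\<close> is in
  \<open>M\<close>.\<close>

lemma frobenius_power_splitting_ideal_subset:
  assumes "ideal M R"
  shows "frobenius_power R p (splitting_ideal R p M e) s \<subseteq> splitting_ideal R p M (e + s)"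
proof (rule frobenius_power_subset[OF splitting_ideal_ideal[OF assms]])
  fix f assume f: "f \<in> splitting_ideal R p M e"
  have "(\<lambda>x. \<psi> (x [^] (p ^ s))) \<in> frobenius_linear_maps e"
    if "\<psi> \<in> frobenius_linear_maps (e + s)" for \<psi>
    using that unfolding frobenius_linear_maps_iff
    by (auto simp: frobenius_add nat_pow_distrib pow_pow_p)
  with f show "f [^] (p ^ s) \<in> splitting_ideal R p M (e + s)"
    unfolding splitting_ideal_def by auto
qed

text \<open>A Cartier map sends \<open>x [^] (p ^ e)\<close> to
  \<open>x \<otimes> \<psi> \<one>\<close>, a multiple of \<open>x\<close>.\<close>

lemma frobenius_power_subset_splitting_ideal:
  assumes "ideal M R"
  shows "frobenius_power R p M e \<subseteq> splitting_ideal R p M e"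
proof (rule frobenius_power_subset[OF splitting_ideal_ideal[OF assms]])
  fix x assume x: "x \<in> M"
  have xc: "x \<in> carrier R" by (rule ideal.Icarr[OF assms x])
  have "\<psi> (x [^] (p ^ e)) \<in> M" if "\<psi> \<in> frobenius_linear_maps e" for \<psi>
  proof -
    have "\<psi> (x [^] (p ^ e) \<otimes> \<one>) = x \<otimes> \<psi> \<one>" "\<psi> \<one> \<in> carrier R"
      using that xc unfolding frobenius_linear_maps_iff by blast+
    then show ?thesis using ideal.I_r_closed[OF assms x] xc by simp
  qed
  with xc show "x [^] (p ^ e) \<in> splitting_ideal R p M e"
    by (simp add: splitting_ideal_def)
qed

end


section \<open>Thresholds as limits\<close>

lemma scaled_sequence_convergent:
  fixes L :: "nat \<Rightarrow> nat"
  assumes p: "p \<ge> 2" and L: "\<And>e. L (Suc e) \<le> p * (L e + n)"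
  obtains l where "(\<lambda>e. real (L e) / real (p ^ e)) \<longlonglongrightarrow> l"
    and "\<And>e. l \<le> real (L e + 2 * n) / real (p ^ e)"
proof -
  define u where "u = (\<lambda>e. real (L e + 2 * n) / real (p ^ e))"
  \<comment> \<open>The shift by \<open>2 * n\<close> is chosen for this:
    \<open>p * n + 2 * n\<close> is at most \<open>2 * p * n\<close> because
    \<open>p \<ge> 2\<close>. Divided by \<open>p ^ e\<close>, the shift tends to zero and leaves
    the limit unchanged.\<close>
  have "u (Suc e) \<le> u e" for e
  proof -
    have "L (Suc e) \<le> p * L e + p * n" "p * (L e + 2 * n) = p * L e + (p * n + p * n)"
      using L[of e] by (simp_all add: algebra_simps)
    then have "L (Suc e) + 2 * n \<le> p * (L e + 2 * n)"
      using mult_le_mono1[OF p, of n] by linarith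
    then have "real (L (Suc e) + 2 * n) \<le> real p * real (L e + 2 * n)"
      by (metis of_nat_le_iff of_nat_mult)
    then have "u (Suc e) \<le> (real p * real (L e + 2 * n)) / (real p * real (p ^ e))"
      unfolding u_def power_Suc of_nat_mult by (intro divide_right_mono) auto
    also have "\<dots> = u e" unfolding u_def using p by simp
    finally show ?thesis .
  qed
  then have "decseq u" by (rule decseq_SucI)
  moreover have "0 \<le> u e" for e by (simp add: u_def)
  ultimately obtain l where l: "u \<longlonglongrightarrow> l" "\<forall>e. l \<le> u e"
    using decseq_convergent[of u 0] by metis
  have "(\<lambda>e. real (2 * n) / real (p ^ e)) \<longlonglongrightarrow> 0"
    using p by (auto intro!: LIMSEQ_divide_realpow_zero)
  from tendsto_diff[OF l(1) this] have "(\<lambda>e. real (L e) / real (p ^ e)) \<longlonglongrightarrow> l"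
    by (simp add: u_def add_divide_distrib)
  with l(2) show thesis by (intro that) (auto simp: u_def)
qed

text \<open>The constant absorbs the unspecified value of \<open>Max {}\<close>, which occurs when an ideal is
  improper: thresholds with respect to improper ideals vanish.\<close>

lemma Max_lessThan_close:
  "\<bar>real (Max {..<n}) - real n\<bar> \<le> 1 + real (Max ({}::nat set))"
proof (cases n)
  case (Suc k)
  have "Max {..<Suc k} = k" by (rule Max_eqI) auto
  then show ?thesis by (simp add: Suc)
qed simp

text \<open>The greatest exponent of noncontainment differs by a bounded amount from the least
  exponent of containment, so both have the same limit after scaling.\<close>

lemma Max_lessThan_scaled_tendsto:
  assumes p: "p \<ge> (2::nat)" and L: "(\<lambda>e. real (L e) / real (p ^ e)) \<longlonglongrightarrow> l"
  shows "(\<lambda>e. real (Max {..<L e}) / real (p ^ e)) \<longlonglongrightarrow> l"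
proof -
  let ?C = "1 + real (Max ({}::nat set))"
  have "(\<lambda>e. ?C / real (p ^ e)) \<longlonglongrightarrow> 0"
    using p by (auto intro!: LIMSEQ_divide_realpow_zero)
  then have "(\<lambda>e. (real (Max {..<L e}) - real (L e)) / real (p ^ e)) \<longlonglongrightarrow> 0"
  proof (rule tendsto_0_le[where K = 1], intro always_eventually allI)
    fix e
    show "norm ((real (Max {..<L e}) - real (L e)) / real (p ^ e)) \<le> norm (?C / real (p ^ e)) * 1"
      using Max_lessThan_close[of "L e"] by (simp add: abs_divide divide_right_mono)
  qed
  from tendsto_add[OF this L] show ?thesis by (simp add: diff_divide_distrib)
qed

section \<open>Containment orders and convergence to \<open>F\<close>-thresholds\<close>

locale threshold_setting = prime_characteristic_ring +
  fixes \<aa> S \<mm> :: "'a set"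
  assumes \<aa>_gen: "\<aa> = Idl S" and S_carrier: "S \<subseteq> carrier R" and S_finite: "finite S"
    and \<mm>_ideal: "ideal \<mm> R" and \<aa>_subset: "\<aa> \<subseteq> \<mm>"
begin

lemma \<aa>_ideal: "ideal \<aa> R"
  unfolding \<aa>_gen by (rule genideal_ideal[OF S_carrier])

text \<open>The number \<open>N(J)\<close>. Unlike a maximum over noncontainments, it has the
  definite value 0 when \<open>J\<close> is the whole ring.\<close>

definition containment_order :: "'a set \<Rightarrow> nat" where
  "containment_order J = (LEAST t. ideal_pow \<aa> t \<subseteq> J)"

definition contains_power :: "'a set \<Rightarrow> bool" where
  "contains_power J \<longleftrightarrow> ideal J R \<and> (\<exists>t. ideal_pow \<aa> t \<subseteq> J)"

lemma containment_order_le: "ideal_pow \<aa> t \<subseteq> J \<Longrightarrow> containment_order J \<le> t"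
  unfolding containment_order_def by (rule Least_le)

lemma ideal_pow_containment_order: "contains_power J \<Longrightarrow> ideal_pow \<aa> (containment_order J) \<subseteq> J"
  unfolding containment_order_def contains_power_def by (elim conjE exE) (rule LeastI)

lemma containment_order_mono:
  "contains_power J \<Longrightarrow> J \<subseteq> J' \<Longrightarrow> containment_order J' \<le> containment_order J"
  by (rule containment_order_le[OF subset_trans[OF ideal_pow_containment_order]])

text \<open>Powers of \<open>\<aa>\<close> decrease, so the exponents of noncontainment form an
  initial segment. This is the link to the maxima in \<open>nu\<close> and
  \<open>b_number\<close>.\<close>

lemma noncontainment_set_eq:
  assumes "contains_power J"
  shows "{t. \<not> ideal_pow \<aa> t \<subseteq> J} = {..<containment_order J}"
proof -
  have "ideal_pow \<aa> t \<subseteq> J" if "containment_order J \<le> t" for t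
    using ideal_pow_antimono[OF \<aa>_ideal that] ideal_pow_containment_order[OF assms]
    by (rule subset_trans)
  then have "ideal_pow \<aa> t \<subseteq> J \<longleftrightarrow> containment_order J \<le> t" for t
    using containment_order_le by (rule iffI[rotated])
  then show ?thesis by auto
qed

lemma contains_power_carrier: "contains_power J \<Longrightarrow> J \<subseteq> carrier R"
  unfolding contains_power_def by (auto intro: ideal.Icarr)

lemma frobenius_power_contains_power:
  assumes "contains_power J"
  shows "contains_power (frobenius_power R p J e)"
    and "containment_order (frobenius_power R p J e) \<le> p ^ e * (containment_order J + card S)"
proof -
  have *: "ideal_pow \<aa> (p ^ e * (containment_order J + card S)) \<subseteq> frobenius_power R p J e"
    by (rule ideal_pow_subset_frobenius_power[OF \<aa>_gen S_carrier S_finite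
          ideal_pow_containment_order[OF assms] contains_power_carrier[OF assms]])
  show "contains_power (frobenius_power R p J e)"
    unfolding contains_power_def
    by (intro conjI exI frobenius_power_ideal contains_power_carrier assms) (rule *)
  show "containment_order (frobenius_power R p J e) \<le> p ^ e * (containment_order J + card S)"
    by (rule containment_order_le[OF *])
qed

lemma contains_power_mono: "contains_power J \<Longrightarrow> J \<subseteq> J' \<Longrightarrow> ideal J' R \<Longrightarrow> contains_power J'"
  unfolding contains_power_def by (elim conjE exE) (intro conjI exI, assumption, rule subset_trans)

lemma contains_power_\<mm>: "contains_power \<mm>"
proof -
  have "ideal_pow \<aa> 1 \<subseteq> \<aa>"
    using ideal_prod_inter[OF ideal_pow_ideal[OF \<aa>_ideal, of 0] \<aa>_ideal]
    unfolding One_nat_def ideal_pow_Suc by (rule subset_trans) (rule Int_lower2)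
  then have "ideal_pow \<aa> 1 \<subseteq> \<mm>" using \<aa>_subset by (rule subset_trans)
  with \<mm>_ideal show ?thesis unfolding contains_power_def by (intro conjI exI)
qed

lemma F_threshold_tendsto:
  assumes J: "contains_power J"
  shows "(\<lambda>e. real (containment_order (frobenius_power R p J e)) / real (p ^ e))
      \<longlonglongrightarrow> F_threshold R p J \<aa>"
    and "F_threshold R p J \<aa> \<le> real (containment_order J + 2 * card S)"
proof -
  let ?L = "\<lambda>e. containment_order (frobenius_power R p J e)"
  have Je: "contains_power (frobenius_power R p J e)" for e
    by (rule frobenius_power_contains_power[OF J])
  \<comment> \<open>One further Frobenius power turns the exponent \<open>e\<close> into
    \<open>e + 1\<close>, so the general estimate becomes a recursion.\<close>
  have "?L (Suc e) \<le> p * (?L e + card S)" for e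
    using frobenius_power_contains_power(2)[OF Je, of e 1]
      frobenius_power_frobenius_power[OF contains_power_carrier[OF J], of e 1]
    by simp
  then obtain l where l: "(\<lambda>e. real (?L e) / real (p ^ e)) \<longlonglongrightarrow> l"
    "\<And>e. l \<le> real (?L e + 2 * card S) / real (p ^ e)"
    using scaled_sequence_convergent[OF p_ge_2, of ?L "card S"] by blast
  have "nu R p J \<aa> e = Max {..<?L e}" for e
    unfolding nu_def noncontainment_set_eq[OF Je] ..
  with Max_lessThan_scaled_tendsto[OF p_ge_2 l(1)]
  have "(\<lambda>e. real (nu R p J \<aa> e) / real (p ^ e)) \<longlonglongrightarrow> l" by simp
  then have eq: "F_threshold R p J \<aa> = l"
    unfolding F_threshold_def by (rule limI)
  show "(\<lambda>e. real (?L e) / real (p ^ e)) \<longlonglongrightarrow> F_threshold R p J \<aa>"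
    unfolding eq by (rule l(1))
  \<comment> \<open>This is the bound on the limit at \<open>e = 0\<close>, where the Frobenius
    power is \<open>J\<close> itself.\<close>
  show "F_threshold R p J \<aa> \<le> real (containment_order J + 2 * card S)"
    using l(2)[of 0] J unfolding eq by (simp add: frobenius_power_0 contains_power_def)
qed

lemma F_threshold_antimono:
  assumes "contains_power J" "J \<subseteq> J'" "ideal J' R"
  shows "F_threshold R p J' \<aa> \<le> F_threshold R p J \<aa>"
proof (rule LIMSEQ_le)
  have J': "contains_power J'" by (rule contains_power_mono[OF assms])
  show "(\<lambda>e. real (containment_order (frobenius_power R p J' e)) / real (p ^ e))
      \<longlonglongrightarrow> F_threshold R p J' \<aa>"
    by (rule F_threshold_tendsto(1)[OF J'])
  show "(\<lambda>e. real (containment_order (frobenius_power R p J e)) / real (p ^ e))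
      \<longlonglongrightarrow> F_threshold R p J \<aa>"
    by (rule F_threshold_tendsto(1)[OF assms(1)])
  have "containment_order (frobenius_power R p J' e) \<le> containment_order (frobenius_power R p J e)" for e
    by (rule containment_order_mono[OF frobenius_power_contains_power(1)[OF assms(1)]
          frobenius_power_mono[OF assms(2) contains_power_carrier[OF J']]])
  then show "\<exists>N. \<forall>e\<ge>N. real (containment_order (frobenius_power R p J' e)) / real (p ^ e)
      \<le> real (containment_order (frobenius_power R p J e)) / real (p ^ e)"
    by (simp add: divide_right_mono)
qed

text \<open>The sequence defining the left side is \<open>p ^ e\<close> times the sequence for
  \<open>J\<close> shifted by \<open>e\<close>.\<close>

lemma F_threshold_frobenius_power:
  assumes J: "contains_power J"
  shows "F_threshold R p (frobenius_power R p J e) \<aa> = real (p ^ e) * F_threshold R p J \<aa>"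
proof (rule LIMSEQ_unique)
  show "(\<lambda>s. real (containment_order (frobenius_power R p (frobenius_power R p J e) s)) / real (p ^ s))
      \<longlonglongrightarrow> F_threshold R p (frobenius_power R p J e) \<aa>"
    by (rule F_threshold_tendsto[OF frobenius_power_contains_power(1)[OF J]])
  have "(\<lambda>s. real (p ^ e) * (real (containment_order (frobenius_power R p J (s + e))) / real (p ^ (s + e))))
      \<longlonglongrightarrow> real (p ^ e) * F_threshold R p J \<aa>"
    by (rule tendsto_mult_left[OF LIMSEQ_ignore_initial_segment[OF F_threshold_tendsto(1)[OF J]]])
  also have "(\<lambda>s. real (p ^ e) * (real (containment_order (frobenius_power R p J (s + e))) / real (p ^ (s + e))))
      = (\<lambda>s. real (containment_order (frobenius_power R p (frobenius_power R p J e) s)) / real (p ^ s))"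
    using p_ge_2
    by (simp add: frobenius_power_frobenius_power[OF contains_power_carrier[OF J]] power_add add.commute[of e])
  finally show "(\<lambda>s. real (containment_order (frobenius_power R p (frobenius_power R p J e) s)) / real (p ^ s))
      \<longlonglongrightarrow> real (p ^ e) * F_threshold R p J \<aa>" .
qed

section \<open>The \<open>F\<close>-pure threshold and the thresholds of the ideals
  \<open>I_e\<close>\<close>

abbreviation split_ideal :: "nat \<Rightarrow> 'a set"
  where "split_ideal \<equiv> splitting_ideal R p \<mm>"

text \<open>The \<open>p ^ e\<close>-th Frobenius power of \<open>\<mm>\<close> contains a power of
  \<open>\<aa>\<close> and lies in \<open>split_ideal e\<close>.\<close>

lemma contains_power_split_ideal: "contains_power (split_ideal e)"
  by (rule contains_power_mono[OF frobenius_power_contains_power(1)[OF contains_power_\<mm>, of e]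
        frobenius_power_subset_splitting_ideal splitting_ideal_ideal]) (rule \<mm>_ideal)+

lemma containment_order_split_ideal_le:
  "containment_order (split_ideal (e + s)) \<le> containment_order (frobenius_power R p (split_ideal e) s)"
  by (rule containment_order_mono[OF
        frobenius_power_contains_power(1)[OF contains_power_split_ideal]
        frobenius_power_splitting_ideal_subset[OF \<mm>_ideal]])

lemma fpt_tendsto:
  "(\<lambda>e. real (containment_order (split_ideal e)) / real (p ^ e)) \<longlonglongrightarrow> fpt R p \<mm> \<aa>"
proof -
  let ?L = "\<lambda>e. containment_order (split_ideal e)"
  \<comment> \<open>The inclusion of the first Frobenius power of \<open>split_ideal e\<close> in
    the next splitting ideal supplies the recursion.\<close>
  have "?L (Suc e) \<le> p * (?L e + card S)" for e
    using containment_order_split_ideal_le[of e 1]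
      frobenius_power_contains_power(2)[OF contains_power_split_ideal, of e 1] by simp
  then obtain l where l: "(\<lambda>e. real (?L e) / real (p ^ e)) \<longlonglongrightarrow> l"
    using scaled_sequence_convergent[OF p_ge_2, of ?L "card S"] by blast
  have "b_number R p \<mm> \<aa> e = Max {..<?L e}" for e
    unfolding b_number_def noncontainment_set_eq[OF contains_power_split_ideal] ..
  with Max_lessThan_scaled_tendsto[OF p_ge_2 l]
  have "(\<lambda>e. real (b_number R p \<mm> \<aa> e) / real (p ^ e)) \<longlonglongrightarrow> l" by simp
  then have "fpt R p \<mm> \<aa> = l"
    unfolding fpt_def by (rule limI)
  with l show ?thesis by simp
qed

text \<open>With \<open>e\<close> fixed, divide \<open>containment_order_split_ideal_le\<close> by
  \<open>p ^ s\<close> and let \<open>s\<close> tend to infinity.\<close>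

lemma fpt_le_F_threshold_split_ideal:
  "real (p ^ e) * fpt R p \<mm> \<aa> \<le> F_threshold R p (split_ideal e) \<aa>"
proof (rule LIMSEQ_le)
  show "(\<lambda>s. real (p ^ e) * (real (containment_order (split_ideal (s + e))) / real (p ^ (s + e))))
      \<longlonglongrightarrow> real (p ^ e) * fpt R p \<mm> \<aa>"
    by (rule tendsto_mult_left[OF LIMSEQ_ignore_initial_segment[OF fpt_tendsto]])
  show "(\<lambda>s. real (containment_order (frobenius_power R p (split_ideal e) s)) / real (p ^ s))
      \<longlonglongrightarrow> F_threshold R p (split_ideal e) \<aa>"
    by (rule F_threshold_tendsto[OF contains_power_split_ideal])
  have "real (p ^ e) * (real (containment_order (split_ideal (s + e))) / real (p ^ (s + e)))
      \<le> real (containment_order (frobenius_power R p (split_ideal e) s)) / real (p ^ s)" for s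
  proof -
    have "real (p ^ e) * (real (containment_order (split_ideal (s + e))) / real (p ^ (s + e)))
        = real (containment_order (split_ideal (e + s))) / real (p ^ s)"
      using p_ge_2 by (simp add: power_add add.commute[of e])
    then show ?thesis
      using containment_order_split_ideal_le[of e s] by (simp add: divide_right_mono)
  qed
  then show "\<exists>N. \<forall>s\<ge>N. real (p ^ e) * (real (containment_order (split_ideal (s + e))) / real (p ^ (s + e)))
      \<le> real (containment_order (frobenius_power R p (split_ideal e) s)) / real (p ^ s)"
    by blast
qed

text \<open>The upper bound exceeds \<open>containment_order (split_ideal e)\<close> by a constant,
  which disappears after division by \<open>p ^ e\<close>.\<close>

lemma F_threshold_split_ideal_tendsto:
  "(\<lambda>e. F_threshold R p (split_ideal e) \<aa> / real (p ^ e)) \<longlonglongrightarrow> fpt R p \<mm> \<aa>"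
proof (rule tendsto_sandwich[OF always_eventually always_eventually])
  have pos: "real (p ^ e) > 0" for e using p_ge_2 by simp
  show "\<forall>e. fpt R p \<mm> \<aa> \<le> F_threshold R p (split_ideal e) \<aa> / real (p ^ e)"
    using fpt_le_F_threshold_split_ideal pos
    by (metis mult.commute pos_le_divide_eq)
  show "\<forall>e. F_threshold R p (split_ideal e) \<aa> / real (p ^ e)
      \<le> real (containment_order (split_ideal e) + 2 * card S) / real (p ^ e)"
    using F_threshold_tendsto(2)[OF contains_power_split_ideal] by (simp add: divide_right_mono)
  have "(\<lambda>e. real (2 * card S) / real (p ^ e)) \<longlonglongrightarrow> 0"
    using p_ge_2 by (auto intro!: LIMSEQ_divide_realpow_zero)
  from tendsto_add[OF fpt_tendsto this]
  show "(\<lambda>e. real (containment_order (split_ideal e) + 2 * card S) / real (p ^ e))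
      \<longlonglongrightarrow> fpt R p \<mm> \<aa>"
    by (simp add: add_divide_distrib)
qed simp

theorem fpt_eq_F_threshold_iff:
  "fpt R p \<mm> \<aa> = F_threshold R p \<mm> \<aa> \<longleftrightarrow>
    (\<forall>e. F_threshold R p (split_ideal e) \<aa> = F_threshold R p (frobenius_power R p \<mm> e) \<aa>)"
proof
  assume eq: "fpt R p \<mm> \<aa> = F_threshold R p \<mm> \<aa>"
  show "\<forall>e. F_threshold R p (split_ideal e) \<aa> = F_threshold R p (frobenius_power R p \<mm> e) \<aa>"
  proof (intro allI antisym)
    fix e
    show "F_threshold R p (split_ideal e) \<aa> \<le> F_threshold R p (frobenius_power R p \<mm> e) \<aa>"
      by (rule F_threshold_antimono[OF frobenius_power_contains_power(1)[OF contains_power_\<mm>]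
            frobenius_power_subset_splitting_ideal splitting_ideal_ideal]) (rule \<mm>_ideal)+
    \<comment> \<open>Under \<open>eq\<close>, the lower bound \<open>p ^ e * fpt\<close> equals the
      threshold of the Frobenius power of \<open>\<mm>\<close>.\<close>
    show "F_threshold R p (frobenius_power R p \<mm> e) \<aa> \<le> F_threshold R p (split_ideal e) \<aa>"
      using fpt_le_F_threshold_split_ideal[of e]
      unfolding F_threshold_frobenius_power[OF contains_power_\<mm>] eq .
  qed
next
  assume eq: "\<forall>e. F_threshold R p (split_ideal e) \<aa> = F_threshold R p (frobenius_power R p \<mm> e) \<aa>"
  \<comment> \<open>The sequence that converges to the \<open>F\<close>-pure threshold is constant
    here.\<close>
  have "F_threshold R p (split_ideal e) \<aa> / real (p ^ e) = F_threshold R p \<mm> \<aa>" for e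
    using eq F_threshold_frobenius_power[OF contains_power_\<mm>, of e] p_ge_2 by simp
  with F_threshold_split_ideal_tendsto show "fpt R p \<mm> \<aa> = F_threshold R p \<mm> \<aa>"
    by (simp add: LIMSEQ_const_iff)
qed

end

section \<open>Hilbert's basis theorem for subrings\<close>

context cring
begin

text \<open>Ideals of \<open>A\<close> are described inside the fixed ring \<open>R\<close>, because
  \<open>A\<close> grows during the adjunction of generators. For a subring, negatives come from
  \<open>\<ominus> \<one> \<in> A\<close>.\<close>

definition subring_ideal :: "'a set \<Rightarrow> 'a set \<Rightarrow> bool" where
  "subring_ideal A I \<longleftrightarrow> I \<subseteq> A \<and> \<zero> \<in> I \<and> (\<forall>x\<in>I. \<forall>y\<in>I. x \<oplus> y \<in> I)
    \<and> (\<forall>a\<in>A. \<forall>x\<in>I. a \<otimes> x \<in> I)"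

lemma subring_idealI:
  assumes "\<And>x. x \<in> I \<Longrightarrow> x \<in> A" "\<zero> \<in> I" "\<And>x y. x \<in> I \<Longrightarrow> y \<in> I \<Longrightarrow> x \<oplus> y \<in> I"
    "\<And>a x. a \<in> A \<Longrightarrow> x \<in> I \<Longrightarrow> a \<otimes> x \<in> I"
  shows "subring_ideal A I"
  using assms unfolding subring_ideal_def by blast

lemma subring_idealD:
  assumes "subring_ideal A I"
  shows "I \<subseteq> A" "\<zero> \<in> I" "\<And>x y. x \<in> I \<Longrightarrow> y \<in> I \<Longrightarrow> x \<oplus> y \<in> I"
    "\<And>a x. a \<in> A \<Longrightarrow> x \<in> I \<Longrightarrow> a \<otimes> x \<in> I"
  using assms unfolding subring_ideal_def by blast+

lemma subring_ideal_Int: "subring_ideal A I \<Longrightarrow> subring_ideal A J \<Longrightarrow> subring_ideal A (I \<inter> J)"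
  by (rule subring_idealI) (auto dest: subring_idealD)

lemma subring_ideal_minus:
  assumes "subring A R" "subring_ideal A I" "x \<in> I" "y \<in> I"
  shows "x \<ominus> y \<in> I"
proof -
  have "y \<in> carrier R" using subring_idealD(1)[OF assms(2)] subringE(1)[OF assms(1)] assms(4) by blast
  moreover have "\<ominus> \<one> \<otimes> y \<in> I"
    by (intro subring_idealD(4)[OF assms(2)] subringE(5,3)[OF assms(1)] assms(4))
  ultimately show ?thesis
    using subring_idealD(3)[OF assms(2,3)] by (simp add: l_minus a_minus_def)
qed

text \<open>Generation of \<open>I\<close> by \<open>S\<close> is phrased as minimality among the
  ideals containing \<open>S\<close>, which avoids writing linear combinations.\<close>

definition noetherian_subring :: "'a set \<Rightarrow> bool" where
  "noetherian_subring A \<longleftrightarrow> subring A R \<and>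
    (\<forall>I. subring_ideal A I \<longrightarrow>
      (\<exists>S. finite S \<and> S \<subseteq> I \<and> (\<forall>J. subring_ideal A J \<longrightarrow> S \<subseteq> J \<longrightarrow> I \<subseteq> J)))"

lemma noetherian_subring_subring: "noetherian_subring A \<Longrightarrow> subring A R"
  by (simp add: noetherian_subring_def)

lemma noetherian_subring_finite_generators:
  assumes "noetherian_subring A" "subring_ideal A I"
  shows "\<exists>S. finite S \<and> S \<subseteq> I \<and> (\<forall>J. subring_ideal A J \<longrightarrow> S \<subseteq> J \<longrightarrow> I \<subseteq> J)"
  using assms unfolding noetherian_subring_def by blast

text \<open>Any nonzero element \<open>u\<close> generates a nonzero ideal, since
  \<open>y = (y \<otimes> inv u) \<otimes> u\<close>.\<close>

lemma subfield_noetherian_subring: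
  assumes K: "subfield K R"
  shows "noetherian_subring K"
  unfolding noetherian_subring_def
proof (intro conjI allI impI)
  show "subring K R" by (rule subfieldE(1)[OF K])
  fix I assume I: "subring_ideal K I"
  show "\<exists>S. finite S \<and> S \<subseteq> I \<and> (\<forall>J. subring_ideal K J \<longrightarrow> S \<subseteq> J \<longrightarrow> I \<subseteq> J)"
  proof (cases "I = {\<zero>}")
    case True
    then show ?thesis by (intro exI[of _ "{}"]) (auto dest: subring_idealD)
  next
    case False
    with subring_idealD(2)[OF I] obtain u where u: "u \<in> I" "u \<noteq> \<zero>" by blast
    have uK: "u \<in> K - {\<zero>}" using u subring_idealD(1)[OF I] by blast
    have "I \<subseteq> J" if J: "subring_ideal K J" "u \<in> J" for J
    proof
      fix y assume "y \<in> I"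
      then have y: "y \<in> K" using subring_idealD(1)[OF I] by blast
      have inv: "inv u \<in> K" "inv u \<otimes> u = \<one>" using subfield_m_inv[OF K uK] by auto
      have "(y \<otimes> inv u) \<otimes> u \<in> J"
        by (intro subring_idealD(4)[OF J(1)] subringE(6)[OF subfieldE(1)[OF K]] y inv J(2))
      then show "y \<in> J"
        using y inv uK subfieldE(3)[OF K] by (simp add: m_assoc subset_iff)
    qed
    with u show ?thesis by (intro exI[of _ "{u}"]) auto
  qed
qed

section \<open>Values at \<open>x\<close> of polynomials over \<open>A\<close> of degree less than
  \<open>d\<close>\<close>

primrec polys_below :: "'a set \<Rightarrow> 'a \<Rightarrow> nat \<Rightarrow> 'a set" where
  "polys_below A x 0 = {\<zero>}"
| "polys_below A x (Suc d) = {P \<oplus> c \<otimes> x [^] d | P c. P \<in> polys_below A x d \<and> c \<in> A}"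

text \<open>The ring \<open>A[x]\<close> inside \<open>R\<close>.\<close>

definition adjoin :: "'a set \<Rightarrow> 'a \<Rightarrow> 'a set" where
  "adjoin A x = (\<Union>d. polys_below A x d)"

context
  fixes A :: "'a set" and x :: 'a
  assumes A: "subring A R" and x [simp]: "x \<in> carrier R"
begin

lemma A_carrier [simp]: "a \<in> A \<Longrightarrow> a \<in> carrier R"
  using subringE(1)[OF A] by blast

lemma polys_below_closed [simp]: "P \<in> polys_below A x d \<Longrightarrow> P \<in> carrier R"
  by (induction d arbitrary: P) auto

lemma polys_below_SucI:
  "P \<in> polys_below A x d \<Longrightarrow> c \<in> A \<Longrightarrow> P \<oplus> c \<otimes> x [^] d \<in> polys_below A x (Suc d)"
  by auto

lemma polys_below_SucE:
  assumes "y \<in> polys_below A x (Suc d)"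
  obtains P c where "P \<in> polys_below A x d" "c \<in> A" "y = P \<oplus> c \<otimes> x [^] d"
  using assms by auto

lemma polys_below_Suc_mono: "P \<in> polys_below A x d \<Longrightarrow> P \<in> polys_below A x (Suc d)"
  using polys_below_SucI[of P d \<zero>] subringE(2)[OF A] by simp

lemma polys_below_mono: "d \<le> e \<Longrightarrow> P \<in> polys_below A x d \<Longrightarrow> P \<in> polys_below A x e"
  by (induction e rule: dec_induct) (use polys_below_Suc_mono in blast)+

lemma zero_polys_below: "\<zero> \<in> polys_below A x d"
  by (rule polys_below_mono[of 0]) auto

lemma polys_below_add:
  "P \<in> polys_below A x d \<Longrightarrow> Q \<in> polys_below A x d \<Longrightarrow> P \<oplus> Q \<in> polys_below A x d"
proof (induction d arbitrary: P Q)
  case (Suc d)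
  obtain P' a where P: "P' \<in> polys_below A x d" "a \<in> A" "P = P' \<oplus> a \<otimes> x [^] d"
    using Suc.prems(1) by (rule polys_below_SucE)
  obtain Q' b where Q: "Q' \<in> polys_below A x d" "b \<in> A" "Q = Q' \<oplus> b \<otimes> x [^] d"
    using Suc.prems(2) by (rule polys_below_SucE)
  have "(P' \<oplus> Q') \<oplus> (a \<oplus> b) \<otimes> x [^] d \<in> polys_below A x (Suc d)"
    by (intro polys_below_SucI Suc.IH P Q subringE(7)[OF A])
  also have "(P' \<oplus> Q') \<oplus> (a \<oplus> b) \<otimes> x [^] d = P \<oplus> Q"
    using P Q by (simp add: l_distr a_ac)
  finally show ?case .
qed simp

lemma polys_below_scale:
  assumes a: "a \<in> A"
  shows "P \<in> polys_below A x d \<Longrightarrow> a \<otimes> P \<in> polys_below A x d"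
proof (induction d arbitrary: P)
  case (Suc d)
  obtain P' c where P: "P' \<in> polys_below A x d" "c \<in> A" "P = P' \<oplus> c \<otimes> x [^] d"
    using Suc.prems by (rule polys_below_SucE)
  have "a \<otimes> P' \<oplus> (a \<otimes> c) \<otimes> x [^] d \<in> polys_below A x (Suc d)"
    by (intro polys_below_SucI Suc.IH P a subringE(6)[OF A])
  also have "a \<otimes> P' \<oplus> (a \<otimes> c) \<otimes> x [^] d = a \<otimes> P"
    using P a by (simp add: r_distr m_assoc)
  finally show ?case .
qed (use a in simp)

lemma polys_below_shift: "P \<in> polys_below A x d \<Longrightarrow> x \<otimes> P \<in> polys_below A x (Suc d)"
proof (induction d arbitrary: P)
  case 0
  then show ?case using zero_polys_below[of 1] by simp
next
  case (Suc d)
  obtain P' c where P: "P' \<in> polys_below A x d" "c \<in> A" "P = P' \<oplus> c \<otimes> x [^] d"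
    using Suc.prems by (rule polys_below_SucE)
  have "x \<otimes> P' \<oplus> c \<otimes> x [^] Suc d \<in> polys_below A x (Suc (Suc d))"
    by (intro polys_below_SucI Suc.IH P)
  also have "x \<otimes> P' \<oplus> c \<otimes> x [^] Suc d = x \<otimes> P"
    using P by (simp add: r_distr m_ac)
  finally show ?case .
qed

lemma adjoin_carrier [simp]: "y \<in> adjoin A x \<Longrightarrow> y \<in> carrier R"
  by (auto simp: adjoin_def)

lemma polys_below_adjoin: "P \<in> polys_below A x d \<Longrightarrow> P \<in> adjoin A x"
  by (auto simp: adjoin_def)

lemma adjoin_add:
  assumes "y \<in> adjoin A x" "z \<in> adjoin A x"
  shows "y \<oplus> z \<in> adjoin A x"
proof -
  obtain d e where "y \<in> polys_below A x d" "z \<in> polys_below A x e"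
    using assms by (auto simp: adjoin_def)
  then have "y \<in> polys_below A x (max d e)" "z \<in> polys_below A x (max d e)"
    by (auto intro: polys_below_mono[rotated])
  then show ?thesis by (intro polys_below_adjoin[OF polys_below_add])
qed

lemma adjoin_scale: "a \<in> A \<Longrightarrow> y \<in> adjoin A x \<Longrightarrow> a \<otimes> y \<in> adjoin A x"
  using polys_below_scale by (auto simp: adjoin_def)

lemma adjoin_pow_mult: "y \<in> adjoin A x \<Longrightarrow> x [^] (n::nat) \<otimes> y \<in> adjoin A x"
proof (induction n)
  case (Suc n)
  then obtain d where "x [^] n \<otimes> y \<in> polys_below A x d" by (auto simp: adjoin_def)
  then have "x \<otimes> (x [^] n \<otimes> y) \<in> adjoin A x" by (intro polys_below_adjoin[OF polys_below_shift])
  moreover have "x \<otimes> (x [^] n \<otimes> y) = x [^] Suc n \<otimes> y"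
    using adjoin_carrier[OF Suc.prems] by (simp add: m_ac)
  ultimately show ?case by simp
qed simp

lemma subset_adjoin: "A \<subseteq> adjoin A x"
proof
  fix a assume "a \<in> A"
  then show "a \<in> adjoin A x"
    using polys_below_SucI[of \<zero> 0 a] by (intro polys_below_adjoin[of _ 1]) simp
qed

lemma self_in_adjoin: "x \<in> adjoin A x"
  using adjoin_pow_mult[of \<one> 1] subset_adjoin subringE(3)[OF A] by auto

lemma adjoin_subring: "subring (adjoin A x) R"
proof (rule subringI)
  show "\<one> \<in> adjoin A x" using subset_adjoin subringE(3)[OF A] by blast
  show "\<ominus> y \<in> adjoin A x" if "y \<in> adjoin A x" for y
    using adjoin_scale[OF subringE(5)[OF A subringE(3)[OF A]] that] adjoin_carrier[OF that]
    by (simp add: l_minus)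
  fix y z assume z: "z \<in> adjoin A x" and "y \<in> adjoin A x"
  then obtain d where "y \<in> polys_below A x d" by (auto simp: adjoin_def)
  then show "y \<otimes> z \<in> adjoin A x"
  proof (induction d arbitrary: y)
    case 0
    then show ?case using polys_below_adjoin[OF zero_polys_below] z by simp
  next
    case (Suc d)
    obtain P c where P: "P \<in> polys_below A x d" "c \<in> A" "y = P \<oplus> c \<otimes> x [^] d"
      using Suc.prems by (rule polys_below_SucE)
    \<comment> \<open>The product is taken apart at the top term of the first factor, whose degree
      bound carries the induction.\<close>
    have "P \<otimes> z \<oplus> c \<otimes> (x [^] d \<otimes> z) \<in> adjoin A x"
      by (intro adjoin_add adjoin_scale adjoin_pow_mult Suc.IH P z)
    also have "P \<otimes> z \<oplus> c \<otimes> (x [^] d \<otimes> z) = y \<otimes> z"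
      using P z by (simp add: l_distr m_assoc)
    finally show ?case .
  qed
qed (use adjoin_add in auto)

section \<open>Leading coefficients in a fixed degree and the basis theorem\<close>

definition leading_coeffs :: "'a set \<Rightarrow> nat \<Rightarrow> 'a set" where
  "leading_coeffs J d = {c \<in> A. \<exists>P \<in> polys_below A x d. P \<oplus> c \<otimes> x [^] d \<in> J}"

lemma leading_coeffs_ideal:
  assumes J: "subring_ideal (adjoin A x) J"
  shows "subring_ideal A (leading_coeffs J d)"
proof (rule subring_idealI)
  show "\<zero> \<in> leading_coeffs J d"
    using subring_idealD(2)[OF J] subringE(2)[OF A]
    by (auto simp: leading_coeffs_def intro!: bexI[OF _ zero_polys_below])
next
  fix a b assume "a \<in> leading_coeffs J d" "b \<in> leading_coeffs J d"
  then obtain P Q where a: "a \<in> A" "P \<in> polys_below A x d" "P \<oplus> a \<otimes> x [^] d \<in> J"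
    and b: "b \<in> A" "Q \<in> polys_below A x d" "Q \<oplus> b \<otimes> x [^] d \<in> J"
    by (auto simp: leading_coeffs_def)
  have "(P \<oplus> a \<otimes> x [^] d) \<oplus> (Q \<oplus> b \<otimes> x [^] d) \<in> J"
    by (rule subring_idealD(3)[OF J a(3) b(3)])
  also have "(P \<oplus> a \<otimes> x [^] d) \<oplus> (Q \<oplus> b \<otimes> x [^] d) = (P \<oplus> Q) \<oplus> (a \<oplus> b) \<otimes> x [^] d"
    using a b by (simp add: l_distr a_ac)
  finally show "a \<oplus> b \<in> leading_coeffs J d"
    using a b polys_below_add subringE(7)[OF A] by (auto simp: leading_coeffs_def)
next
  fix a b assume a: "a \<in> A" and "b \<in> leading_coeffs J d"
  then obtain Q where b: "b \<in> A" "Q \<in> polys_below A x d" "Q \<oplus> b \<otimes> x [^] d \<in> J"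
    by (auto simp: leading_coeffs_def)
  have "a \<otimes> (Q \<oplus> b \<otimes> x [^] d) \<in> J"
    using a subset_adjoin by (intro subring_idealD(4)[OF J _ b(3)]) blast
  also have "a \<otimes> (Q \<oplus> b \<otimes> x [^] d) = a \<otimes> Q \<oplus> (a \<otimes> b) \<otimes> x [^] d"
    using a b by (simp add: r_distr m_assoc)
  finally show "a \<otimes> b \<in> leading_coeffs J d"
    using a b polys_below_scale subringE(6)[OF A] by (auto simp: leading_coeffs_def)
qed (simp add: leading_coeffs_def)

text \<open>Multiplication by \<open>x\<close> raises the degree and keeps the leading
  coefficient.\<close>

lemma leading_coeffs_Suc_mono:
  assumes J: "subring_ideal (adjoin A x) J"
  shows "leading_coeffs J d \<subseteq> leading_coeffs J (Suc d)"
proof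
  fix a assume "a \<in> leading_coeffs J d"
  then obtain P where a: "a \<in> A" "P \<in> polys_below A x d" "P \<oplus> a \<otimes> x [^] d \<in> J"
    by (auto simp: leading_coeffs_def)
  have "x \<otimes> (P \<oplus> a \<otimes> x [^] d) \<in> J"
    by (rule subring_idealD(4)[OF J self_in_adjoin a(3)])
  also have "x \<otimes> (P \<oplus> a \<otimes> x [^] d) = x \<otimes> P \<oplus> a \<otimes> x [^] Suc d"
    using a by (simp add: r_distr m_ac)
  finally show "a \<in> leading_coeffs J (Suc d)"
    using a polys_below_shift unfolding leading_coeffs_def by blast
qed

lemma leading_coeffs_mono:
  assumes "subring_ideal (adjoin A x) J" "d \<le> e"
  shows "leading_coeffs J d \<subseteq> leading_coeffs J e"
  using lift_Suc_mono_le[of "leading_coeffs J", OF leading_coeffs_Suc_mono[OF assms(1)] assms(2)] .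

text \<open>Descent on the degree: \<open>f \<in> I\<close> shares its top coefficient with some
  \<open>g \<in> I \<inter> J\<close>, and \<open>f \<ominus> g\<close> has smaller degree. Taking
  \<open>g\<close> in the intersection keeps the difference in \<open>I\<close>, where the induction
  applies.\<close>

lemma subset_of_leading_coeffs:
  assumes I: "subring_ideal (adjoin A x) I" and J: "subring_ideal (adjoin A x) J"
    and lead: "\<And>d. leading_coeffs I d \<subseteq> leading_coeffs (I \<inter> J) d"
  shows "I \<subseteq> J"
proof -
  have "f \<in> J" if "f \<in> I" "f \<in> polys_below A x d" for f d
    using that
  proof (induction d arbitrary: f)
    case 0
    then show ?case using subring_idealD(2)[OF J] by simp
  next
    case (Suc d)
    obtain P c where P: "P \<in> polys_below A x d" "c \<in> A" "f = P \<oplus> c \<otimes> x [^] d"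
      using Suc.prems(2) by (rule polys_below_SucE)
    with Suc.prems(1) have "c \<in> leading_coeffs I d" by (auto simp: leading_coeffs_def)
    with lead have "c \<in> leading_coeffs (I \<inter> J) d" by blast
    then obtain Q where Q: "Q \<in> polys_below A x d" "Q \<oplus> c \<otimes> x [^] d \<in> I \<inter> J"
      by (auto simp: leading_coeffs_def)
    let ?g = "Q \<oplus> c \<otimes> x [^] d"
    \<comment> \<open>The terms of degree \<open>d\<close> cancel, and only lower terms
      remain.\<close>
    have eq: "f \<ominus> ?g = P \<oplus> \<ominus> \<one> \<otimes> Q"
    proof -
      have "f \<ominus> ?g = (P \<oplus> c \<otimes> x [^] d) \<oplus> (\<ominus> Q \<oplus> \<ominus> (c \<otimes> x [^] d))"
        using P Q by (simp add: a_minus_def minus_add)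
      also have "\<dots> = (P \<oplus> \<ominus> Q) \<oplus> (c \<otimes> x [^] d \<oplus> \<ominus> (c \<otimes> x [^] d))"
        using P Q by (simp add: a_ac del: r_neg)
      also have "\<dots> = P \<oplus> \<ominus> \<one> \<otimes> Q"
        using P Q by (simp add: r_neg l_minus)
      finally show ?thesis .
    qed
    have "f \<ominus> ?g \<in> I"
      using subring_ideal_minus[OF adjoin_subring I Suc.prems(1)] Q(2) by blast
    moreover have "f \<ominus> ?g \<in> polys_below A x d"
      unfolding eq by (intro polys_below_add polys_below_scale P Q subringE(5,3)[OF A])
    ultimately have "f \<ominus> ?g \<in> J" by (rule Suc.IH)
    moreover have "?g \<in> J" using Q(2) by blast
    ultimately have "(f \<ominus> ?g) \<oplus> ?g \<in> J" by (rule subring_idealD(3)[OF J])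
    moreover have "(f \<ominus> ?g) \<oplus> ?g = f"
    proof -
      have "f \<in> carrier R" "?g \<in> carrier R" using P Q by simp_all
      then show ?thesis by (simp add: a_minus_def a_assoc l_neg)
    qed
    ultimately show ?case by simp
  qed
  moreover have "\<exists>d. f \<in> polys_below A x d" if "f \<in> I" for f
    using that subring_idealD(1)[OF I] by (auto simp: adjoin_def)
  ultimately show ?thesis by blast
qed

text \<open>The leading coefficients of elements of degree \<open>d\<close> increase with \<open>d\<close> up to some \<open>D\<close>;
  lifts of generators of the leading coefficients in each degree up to \<open>D\<close> generate the ideal.
  Expressions of elements of the adjunction as polynomials in \<open>x\<close> need not be unique.\<close>

theorem adjoin_noetherian_subring:
  assumes noeth: "noetherian_subring A"
  shows "noetherian_subring (adjoin A x)"
  unfolding noetherian_subring_def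
proof (intro conjI allI impI)
  show "subring (adjoin A x) R" by (rule adjoin_subring)
  fix I assume I: "subring_ideal (adjoin A x) I"
  let ?U = "\<Union>d. leading_coeffs I d"
  have U: "subring_ideal A ?U"
  proof (rule subring_idealI)
    fix a b assume "a \<in> ?U" "b \<in> ?U"
    then obtain d e where "a \<in> leading_coeffs I d" "b \<in> leading_coeffs I e" by blast
    then have "a \<in> leading_coeffs I (max d e)" "b \<in> leading_coeffs I (max d e)"
      using leading_coeffs_mono[OF I, of d "max d e"] leading_coeffs_mono[OF I, of e "max d e"] by auto
    then have "a \<oplus> b \<in> leading_coeffs I (max d e)"
      by (rule subring_idealD(3)[OF leading_coeffs_ideal[OF I]])
    then show "a \<oplus> b \<in> ?U" by blast
  next
    show "\<zero> \<in> ?U" using subring_idealD(2)[OF leading_coeffs_ideal[OF I]] by blast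
  next
    fix a b assume a: "a \<in> A" and "b \<in> ?U"
    then obtain d where "b \<in> leading_coeffs I d" by blast
    then have "a \<otimes> b \<in> leading_coeffs I d"
      by (rule subring_idealD(4)[OF leading_coeffs_ideal[OF I] a])
    then show "a \<otimes> b \<in> ?U" by blast
  qed (auto simp: leading_coeffs_def)
  obtain T where T: "finite T" "T \<subseteq> ?U" "\<And>J. subring_ideal A J \<Longrightarrow> T \<subseteq> J \<Longrightarrow> ?U \<subseteq> J"
    using noetherian_subring_finite_generators[OF noeth U] by blast
  \<comment> \<open>A finite subset of an increasing union lies in a single stage.\<close>
  have "\<exists>D. T \<subseteq> leading_coeffs I D"
    using T(1,2)
  proof (induction T rule: finite_induct)
    case (insert t T)
    then obtain D d where "T \<subseteq> leading_coeffs I D" "t \<in> leading_coeffs I d" by blast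
    then have "insert t T \<subseteq> leading_coeffs I (max D d)"
      using leading_coeffs_mono[OF I, of D "max D d"] leading_coeffs_mono[OF I, of d "max D d"] by auto
    then show ?case by blast
  qed simp
  then obtain D where D: "T \<subseteq> leading_coeffs I D" by blast
  have lead_D: "leading_coeffs I d \<subseteq> leading_coeffs I D" for d
    using T(3)[OF leading_coeffs_ideal[OF I] D] by blast
  obtain S where S: "\<And>d. finite (S d)" "\<And>d. S d \<subseteq> leading_coeffs I d"
    "\<And>d J. subring_ideal A J \<Longrightarrow> S d \<subseteq> J \<Longrightarrow> leading_coeffs I d \<subseteq> J"
    using noetherian_subring_finite_generators[OF noeth leading_coeffs_ideal[OF I]] by metis
  have "\<exists>P. P \<in> polys_below A x d \<and> P \<oplus> c \<otimes> x [^] d \<in> I" if "c \<in> S d" for d c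
    using S(2) that by (auto simp: leading_coeffs_def)
  then have "\<exists>v. \<forall>c\<in>S d. v c \<in> polys_below A x d \<and> v c \<oplus> c \<otimes> x [^] d \<in> I" for d
    by (intro bchoice ballI)
  then have "\<forall>d. \<exists>v. \<forall>c\<in>S d. v c \<in> polys_below A x d \<and> v c \<oplus> c \<otimes> x [^] d \<in> I"
    by (rule allI)
  then obtain w where "\<forall>d. \<forall>c\<in>S d. w d c \<in> polys_below A x d \<and> w d c \<oplus> c \<otimes> x [^] d \<in> I"
    unfolding choice_iff by blast
  then have w: "\<And>d c. c \<in> S d \<Longrightarrow> w d c \<in> polys_below A x d"
    "\<And>d c. c \<in> S d \<Longrightarrow> w d c \<oplus> c \<otimes> x [^] d \<in> I"
    by blast+
  let ?W = "\<Union>d\<in>{..D}. (\<lambda>c. w d c \<oplus> c \<otimes> x [^] d) ` S d"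
  have "I \<subseteq> J" if J: "subring_ideal (adjoin A x) J" "?W \<subseteq> J" for J
  proof (rule subset_of_leading_coeffs[OF I J(1)])
    note IJ = subring_ideal_Int[OF I J(1)]
    have small: "leading_coeffs I d \<subseteq> leading_coeffs (I \<inter> J) d" if "d \<le> D" for d
    proof (rule S(3)[OF leading_coeffs_ideal[OF IJ]], rule subsetI)
      fix c assume c: "c \<in> S d"
      then have "w d c \<oplus> c \<otimes> x [^] d \<in> ?W" using that by blast
      with J(2) have "w d c \<oplus> c \<otimes> x [^] d \<in> I \<inter> J" using w(2)[OF c] by blast
      moreover have "c \<in> A" using S(2) c by (auto simp: leading_coeffs_def)
      ultimately show "c \<in> leading_coeffs (I \<inter> J) d"
        using w(1)[OF c] unfolding leading_coeffs_def by blast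
    qed
    show "leading_coeffs I d \<subseteq> leading_coeffs (I \<inter> J) d" for d
    proof (cases "d \<le> D")
      case False
      \<comment> \<open>Above \<open>D\<close> a leading coefficient already occurs in degree
        \<open>D\<close>, hence for \<open>I \<inter> J\<close> in degree \<open>D\<close>;
        multiplication by powers of \<open>x\<close> brings it back up to degree
        \<open>d\<close>.\<close>
      then show ?thesis
        using lead_D[of d] small[OF order_refl] leading_coeffs_mono[OF IJ, of D d] by simp
    qed (rule small)
  qed
  moreover have "finite ?W" using S(1) by simp
  moreover have "?W \<subseteq> I" using w(2) by blast
  ultimately show "\<exists>S. finite S \<and> S \<subseteq> I \<and> (\<forall>J. subring_ideal (adjoin A x) J \<longrightarrow> S \<subseteq> J \<longrightarrow> I \<subseteq> J)"
    by (intro exI[of _ ?W] conjI allI impI)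
qed

end

text \<open>Adjoining the elements of \<open>S\<close> one at a time gives a Noetherian subring
  containing \<open>A \<union> S\<close>, which must be all of \<open>R\<close>.\<close>

lemma finitely_generated_algebra_noetherian:
  assumes "noetherian_subring A" "finite S" "S \<subseteq> carrier R" "generate_ring R (A \<union> S) = carrier R"
  shows "noetherian_subring (carrier R)"
proof -
  have "\<exists>B. noetherian_subring B \<and> A \<union> S \<subseteq> B"
    using assms(2,3)
  proof (induction S rule: finite_induct)
    case empty
    then show ?case using assms(1) by blast
  next
    case (insert s S)
    then obtain B where B: "noetherian_subring B" "A \<union> S \<subseteq> B" by blast
    have s: "s \<in> carrier R" using insert.prems by blast
    note sub = noetherian_subring_subring[OF B(1)]
    show ?case
      using adjoin_noetherian_subring[OF sub s B(1)] subset_adjoin[OF sub s]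
        self_in_adjoin[OF sub s] B(2) by (intro exI[of _ "adjoin B s"]) auto
  qed
  then obtain B where B: "noetherian_subring B" "A \<union> S \<subseteq> B" by blast
  note sub = noetherian_subring_subring[OF B(1)]
  have "y \<in> B" if "y \<in> generate_ring R (A \<union> S)" for y
    using that by (induction rule: generate_ring.induct) (use B(2) subringE(3,5-7)[OF sub] in auto)
  then have "carrier R = B" using subringE(1)[OF sub] assms(4) by blast
  then show ?thesis using B(1) by simp
qed

lemma noetherian_subring_carrier_finite_generators:
  assumes "noetherian_subring (carrier R)" "ideal I R"
  obtains S where "S \<subseteq> carrier R" "finite S" "I = Idl S"
proof -
  have iff: "subring_ideal (carrier R) J" if "ideal J R" for J
    by (rule subring_idealI)
       (use that in \<open>auto intro: ideal.Icarr ideal_zero_mem ideal_add_mem ideal.I_l_closed\<close>)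
  obtain S where S: "finite S" "S \<subseteq> I" "\<And>J. subring_ideal (carrier R) J \<Longrightarrow> S \<subseteq> J \<Longrightarrow> I \<subseteq> J"
    using noetherian_subring_finite_generators[OF assms(1) iff[OF assms(2)]] by blast
  have c: "S \<subseteq> carrier R" using S(2) by (auto intro: ideal.Icarr[OF assms(2)])
  have "I = Idl S"
    by (rule subset_antisym[OF S(3)[OF iff[OF genideal_ideal[OF c]] genideal_self[OF c]]
          genideal_minimal[OF assms(2) S(2)]])
  with c S(1) show thesis by (intro that)
qed

end

section \<open>Graded and local rings\<close>

context standard_graded_algebra
begin

lemma graded_carrier: "y \<in> G i \<Longrightarrow> y \<in> carrier R"
  using graded_subgroup[of i] by (rule additive_subgroup.a_Hcarr)

lemma graded_zero: "\<zero> \<in> G i"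
  using graded_subgroup[of i] by (rule additive_subgroup.zero_closed)

lemma graded_add: "y \<in> G i \<Longrightarrow> z \<in> G i \<Longrightarrow> y \<oplus> z \<in> G i"
  using graded_subgroup[of i] by (rule additive_subgroup.a_closed)

lemma ideal_finite_generators:
  assumes "ideal I R"
  obtains S where "S \<subseteq> carrier R" "finite S" "I = Idl S"
proof -
  obtain S where S: "finite S" "S \<subseteq> G 1" "generate_ring R (G 0 \<union> S) = carrier R"
    using generated_in_degree_one by blast
  have "S \<subseteq> carrier R" using S(2) graded_carrier by blast
  with S have "noetherian_subring (carrier R)"
    by (intro finitely_generated_algebra_noetherian[OF subfield_noetherian_subring[OF degree_zero_field]])
  then show thesis
    by (rule noetherian_subring_carrier_finite_generators[OF _ assms that])
qed

abbreviation irrelevant :: "'a set" where "irrelevant \<equiv> irrelevant_ideal R G"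

lemma irrelevantI:
  "finite A \<Longrightarrow> 0 \<notin> A \<Longrightarrow> (\<And>i. i \<in> A \<Longrightarrow> f i \<in> G i) \<Longrightarrow> (\<Oplus>i\<in>A. f i) \<in> irrelevant"
  unfolding irrelevant_ideal_def by blast

lemma irrelevantE:
  assumes "y \<in> irrelevant"
  obtains A f where "finite A" "0 \<notin> A" "\<forall>i\<in>A. f i \<in> G i" "y = (\<Oplus>i\<in>A. f i)"
  using assms unfolding irrelevant_ideal_def by blast

lemma graded_in_irrelevant:
  assumes "y \<in> G i" "i \<noteq> 0"
  shows "y \<in> irrelevant"
  using irrelevantI[of "{i}" "\<lambda>_. y"] assms graded_carrier[OF assms(1)] by simp

lemma irrelevant_carrier:
  assumes "y \<in> irrelevant"
  shows "y \<in> carrier R"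
proof -
  obtain A f where "\<forall>i\<in>A. f i \<in> G i" and y: "y = (\<Oplus>i\<in>A. f i)"
    using assms by (rule irrelevantE)
  then have "f \<in> A \<rightarrow> carrier R" using graded_carrier by blast
  then show ?thesis unfolding y by (rule finsum_closed)
qed

lemma irrelevant_zero: "\<zero> \<in> irrelevant"
  using irrelevantI[of "{}" "\<lambda>_. \<zero>"] by simp

lemma irrelevant_add:
  assumes "y \<in> irrelevant" "z \<in> irrelevant"
  shows "y \<oplus> z \<in> irrelevant"
proof -
  obtain A f where A: "finite A" "0 \<notin> A" "\<forall>i\<in>A. f i \<in> G i" "y = (\<Oplus>i\<in>A. f i)"
    using assms(1) by (rule irrelevantE)
  obtain B g where B: "finite B" "0 \<notin> B" "\<forall>i\<in>B. g i \<in> G i" "z = (\<Oplus>i\<in>B. g i)"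
    using assms(2) by (rule irrelevantE)
  \<comment> \<open>Both families are extended by zero so that the sums run over the common index
    set \<open>A \<union> B\<close>.\<close>
  define f' where "f' = (\<lambda>i. if i \<in> A then f i else \<zero>)"
  define g' where "g' = (\<lambda>i. if i \<in> B then g i else \<zero>)"
  have f': "f' i \<in> G i" and g': "g' i \<in> G i" for i
    using A(3) B(3) graded_zero by (auto simp: f'_def g'_def)
  then have carr: "f' i \<in> carrier R" "g' i \<in> carrier R" for i using graded_carrier by blast+
  have "y = (\<Oplus>i\<in>A \<union> B. f' i)"
    unfolding A(4) by (rule add.finprod_mono_neutral_cong_left)
      (use A B carr in \<open>auto simp: f'_def\<close>)
  moreover have "z = (\<Oplus>i\<in>A \<union> B. g' i)"
    unfolding B(4) by (rule add.finprod_mono_neutral_cong_left)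
      (use A B carr in \<open>auto simp: g'_def\<close>)
  ultimately have "y \<oplus> z = (\<Oplus>i\<in>A \<union> B. f' i \<oplus> g' i)"
    using carr by (simp add: finsum_addf Pi_def)
  then show ?thesis
    using irrelevantI[of "A \<union> B" "\<lambda>i. f' i \<oplus> g' i"] A(1,2) B(1,2) f' g' graded_add by simp
qed

lemma irrelevant_finsum:
  "finite A \<Longrightarrow> (\<And>i. i \<in> A \<Longrightarrow> f i \<in> irrelevant) \<Longrightarrow> (\<Oplus>i\<in>A. f i) \<in> irrelevant"
  by (induction A rule: finite_induct)
     (auto simp: irrelevant_zero irrelevant_add irrelevant_carrier Pi_def)

lemma irrelevant_ideal: "ideal irrelevant R"
proof (rule ideal_closedI)
  fix y r assume y: "y \<in> irrelevant" and r: "r \<in> carrier R"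
  obtain A f where A: "finite A" "0 \<notin> A" "\<forall>i\<in>A. f i \<in> G i" "y = (\<Oplus>i\<in>A. f i)"
    using y by (rule irrelevantE)
  have fc: "f \<in> A \<rightarrow> carrier R" using A(3) graded_carrier by blast
  \<comment> \<open>A homogeneous multiplier of degree \<open>j\<close> sends degree
    \<open>i \<noteq> 0\<close> to \<open>j + i \<noteq> 0\<close>; a general \<open>r\<close> is
    then split into its homogeneous components.\<close>
  have hom: "s \<otimes> y \<in> irrelevant" if s: "s \<in> G j" for s j
  proof -
    have "s \<otimes> y = (\<Oplus>i\<in>A. s \<otimes> f i)"
      unfolding A(4) by (rule finsum_rdistr[OF A(1) graded_carrier[OF s] fc])
    moreover have "s \<otimes> f i \<in> irrelevant" if "i \<in> A" for i
      using graded_mult[OF s A(3)[rule_format, OF that]] that A(2)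
      by (intro graded_in_irrelevant[of _ "j + i"]) (auto intro: ccontr)
    ultimately show ?thesis using irrelevant_finsum[OF A(1)] by simp
  qed
  obtain g where g: "\<forall>i. g i \<in> G i" "finite {i. g i \<noteq> \<zero>}" "r = (\<Oplus>i\<in>{i. g i \<noteq> \<zero>}. g i)"
    using graded_direct_sum[OF r] by blast
  have "r \<otimes> y = (\<Oplus>i\<in>{i. g i \<noteq> \<zero>}. g i \<otimes> y)"
    using g(1) by (subst g(3)) (intro finsum_ldistr g(2) irrelevant_carrier[OF y], auto intro: graded_carrier)
  moreover have "(\<Oplus>i\<in>{i. g i \<noteq> \<zero>}. g i \<otimes> y) \<in> irrelevant"
    using g(1) by (intro irrelevant_finsum g(2)) (auto intro: hom)
  ultimately show "r \<otimes> y \<in> irrelevant" by simp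
qed (auto intro: irrelevant_carrier irrelevant_zero irrelevant_add)

text \<open>A nonzero generator of degree zero would be a unit, as \<open>G 0\<close> is a field,
  and would make \<open>I\<close> the whole ring. The remaining homogeneous generators are zero or
  of positive degree.\<close>

lemma homogeneous_ideal_subset_irrelevant:
  assumes "homogeneous_ideal R G I" "I \<noteq> carrier R"
  shows "I \<subseteq> irrelevant"
proof -
  obtain H where H: "H \<subseteq> (\<Union>i. G i)" "I = Idl H" and I: "ideal I R"
    using assms(1) unfolding homogeneous_ideal_def by blast
  have Hc: "H \<subseteq> carrier R" using H(1) graded_carrier by blast
  have HI: "H \<subseteq> I" unfolding H(2) by (rule genideal_self[OF Hc])
  have "h \<in> irrelevant" if h: "h \<in> H" for h
  proof -
    obtain i where i: "h \<in> G i" using h H(1) by blast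
    consider "i \<noteq> 0" | "h = \<zero>" | "i = 0" "h \<noteq> \<zero>" by blast
    then show ?thesis
    proof cases
      case 3
      then have hK: "h \<in> G 0 - {\<zero>}" using i by simp
      have inv: "inv h \<in> carrier R" "inv h \<otimes> h = \<one>"
        using subfield_m_inv[OF degree_zero_field hK] graded_carrier by auto
      have "h \<in> I" using h HI by (rule rev_subsetD)
      then have "\<one> \<in> I" using ideal.I_l_closed[OF I, of h "inv h"] inv by simp
      then show ?thesis using ideal.one_imp_carrier[OF I] assms(2) by simp
    qed (use graded_in_irrelevant i irrelevant_zero in auto)
  qed
  then show ?thesis unfolding H(2) by (intro genideal_minimal[OF irrelevant_ideal] subsetI)
qed

end

section \<open>Maximal ideals in Noetherian rings\<close>

lemma (in noetherian_ring) proper_ideal_subset_maximalideal: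
  assumes I: "ideal I R" "I \<noteq> carrier R"
  obtains M where "maximalideal M R" "I \<subseteq> M"
proof -
  let ?F = "{J. ideal J R \<and> I \<subseteq> J \<and> J \<noteq> carrier R}"
  have "\<exists>M\<in>?F. \<forall>J\<in>?F. M \<subseteq> J \<longrightarrow> J = M"
  proof (rule subset_Zorn_nonempty)
    show "?F \<noteq> {}" using I by blast
    fix C assume C: "C \<noteq> {}" "subset.chain ?F C"
    then have "subset.chain {J. ideal J R} C" unfolding subset.chain_def by blast
    \<comment> \<open>In a Noetherian ring a nonempty chain of ideals contains its union, so the
      union inherits properness.\<close>
    then have "\<Union>C \<in> C" by (rule ideal_chain_is_trivial[OF C(1)])
    then show "\<Union>C \<in> ?F" using C(2) unfolding subset.chain_def by blast
  qed
  then obtain M where M: "M \<in> ?F" and max: "\<forall>J\<in>?F. M \<subseteq> J \<longrightarrow> J = M" by (rule bexE)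
  have "maximalideal M R"
  proof (rule maximalidealI)
    fix J assume J: "ideal J R" "M \<subseteq> J" "J \<subseteq> carrier R"
    show "J = M \<or> J = carrier R"
    proof (cases "J = carrier R")
      case False
      then have "J \<in> ?F" using J M by auto
      with max J(2) show ?thesis by simp
    qed simp
  qed (use M in auto)
  moreover have "I \<subseteq> M" using M by simp
  ultimately show thesis by (rule that)
qed

lemma (in noetherian_local_ring) proper_ideal_subset_maximal:
  assumes "ideal I R" "I \<noteq> carrier R"
  shows "I \<subseteq> \<mm>"
proof -
  obtain M where "maximalideal M R" "I \<subseteq> M"
    using assms by (rule proper_ideal_subset_maximalideal)
  then show ?thesis using unique_maximal[of M] by simp
qed

text \<open>Both cases are reduced to \<open>threshold_setting\<close>. Finite generation of
  \<open>\<aa>\<close> comes from the basis theorem or the Noetherian hypothesis, and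
  \<open>\<aa> \<subseteq> \<mm>\<close> from homogeneity or from uniqueness of the maximal
  ideal.\<close>

theorem corollary4p7:
  fixes R :: "('a, 'b) ring_scheme" (structure)
    and p :: nat
    and \<mm> \<aa> :: "'a set"
    and G :: "nat \<Rightarrow> 'a set"
  assumes "standard_graded_algebra R G \<and> \<mm> = irrelevant_ideal R G \<and> homogeneous_ideal R G \<aa>
      \<or> noetherian_local_ring R \<mm>"
    and "Factorial_Ring.prime p" and "[p] \<cdot> \<one> = \<zero>"
    and "F_finite R p" and "F_pure R p"
    and "ideal \<aa> R" and "\<aa> \<noteq> carrier R"
  shows "fpt R p \<mm> \<aa> = F_threshold R p \<mm> \<aa> \<longleftrightarrow>
    (\<forall>e :: nat. F_threshold R p (splitting_ideal R p \<mm> e) \<aa>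
       = F_threshold R p (frobenius_power R p \<mm> e) \<aa>)"
proof -
  have "\<exists>S. cring R \<and> S \<subseteq> carrier R \<and> finite S \<and> \<aa> = Idl S \<and> ideal \<mm> R \<and> \<aa> \<subseteq> \<mm>"
    using assms(1)
  proof
    assume gr: "standard_graded_algebra R G \<and> \<mm> = irrelevant_ideal R G \<and> homogeneous_ideal R G \<aa>"
    then interpret standard_graded_algebra R G by blast
    obtain S where "S \<subseteq> carrier R" "finite S" "\<aa> = Idl S"
      using assms(6) by (rule ideal_finite_generators)
    then show ?thesis
      using gr cring_axioms irrelevant_ideal homogeneous_ideal_subset_irrelevant assms(7) by auto
  next
    assume "noetherian_local_ring R \<mm>"
    then interpret noetherian_local_ring R \<mm> .
    obtain S where "S \<subseteq> carrier R" "finite S" "\<aa> = Idl S"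
      using finetely_gen[OF assms(6)] by blast
    moreover have "ideal \<mm> R" using maximal by (rule maximalideal.axioms(1))
    ultimately show ?thesis
      using cring_axioms proper_ideal_subset_maximal[OF assms(6,7)] by blast
  qed
  then obtain S where S: "cring R" "S \<subseteq> carrier R" "finite S" "\<aa> = Idl S" "ideal \<mm> R" "\<aa> \<subseteq> \<mm>"
    by blast
  interpret threshold_setting R p \<aa> S \<mm>
    using S assms(2,3)
    by (intro threshold_setting.intro prime_characteristic_ring.intro
        prime_characteristic_ring_axioms.intro threshold_setting_axioms.intro)
  show ?thesis by (rule fpt_eq_F_threshold_iff)
qed

end
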